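(* Let $(K,d,\nu)$ be a metric measure space. Let $(\mathcal{E},\mathcal{F})$ be a regular Dirichlet form on $L^2(K;\nu)$ that corresponds to a Hunt process $\{X_t\}$. Let $A$ be the generator of $(\mathcal{E},\mathcal{F})$ on $L^2(K;\nu)$, which is a non-positive definite self-adjoint operator. For any $\delta\in(0,1)$, let $\{X^{(\delta)}_t\}$ be the $\delta$-subordinated Hunt process, which corresponds to a regular Dirichlet form $(\mathcal{E}^{(\delta)},\mathcal{F}^{(\delta)})$ on $L^2(K;\nu)$. Then $$\mathcal{F}\subseteq\bigcap_{\delta\in(0,1)}\mathcal{F}^{(\delta)},$$ and equality holds if and only if $A$ is bounded.
   Context: A metric measure space $(K,d,\nu)$: $(K,d)$ is a locally compact separable metric space and $\nu$ is a Radon measure on $K$ with full support. $(\cdot,\cdot)$ is the inner product of $L^2(K;\nu)$. Let $\{T_t:t>0\}$ be the strongly continuous Markovian semigroup of $(\mathcal{E},\mathcal{F})$, so $T_t=e^{tA}$, $\mathcal{F}=\mathcal{D}(\sqrt{-A})$ and $\mathcal{E}(u,u)=(\sqrt{-A}u,\sqrt{-A}u)$ for $u\in\mathcal{F}$. For $\delta\in(0,1)$, the $\delta$-stable subordinator $\{\xi^{(\delta)}_t\}$ is the one-dimensional Lévy process with $\mathbb{E}e^{-s\xi^{(\delta)}_t}=e^{-ts^\delta}$ for $s\ge 0$; $\eta^{(\delta)}_t$ denotes the density of $\xi^{(\delta)}_t$ on $(0,+\infty)$. With $\{\xi^{(\delta)}_t\}$ independent of $\{X_t\}$, the $\delta$-subordinated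 process is $X^{(\delta)}_t=X_{\xi^{(\delta)}_t}$. Its semigroup on $L^2(K;\nu)$ is $$T^{(\delta)}_tu=\int_0^{+\infty}T_su\;\eta^{(\delta)}_t(s)\,\mathrm{d}s,\qquad t>0,\ u\in L^2(K;\nu),$$ and $(\mathcal{E}^{(\delta)},\mathcal{F}^{(\delta)})$ is the corresponding regular Dirichlet form: $\mathcal{E}^{(\delta)}(u,u)=\lim_{t\downarrow0}\frac1t(u-T^{(\delta)}_tu,u)\in[0,+\infty]$ and $\mathcal{F}^{(\delta)}=\{u\in L^2(K;\nu):\mathcal{E}^{(\delta)}(u,u)<+\infty\}$. *)

theory Defs
  imports "HOL-Probability.Probability"
begin

section \<open>Metric measure spaces\<close>

definition radon_measure :: "'a::metric_space measure \<Rightarrow> bool" where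
  "radon_measure \<nu> \<longleftrightarrow>
     sets \<nu> = sets borel \<and>
     (\<forall>C. compact C \<longrightarrow> emeasure \<nu> C < \<infinity>) \<and>
     (\<forall>B\<in>sets borel. emeasure \<nu> B = (INF U\<in>{U. open U \<and> B \<subseteq> U}. emeasure \<nu> U)) \<and>
     (\<forall>U. open U \<longrightarrow> emeasure \<nu> U = (SUP C\<in>{C. compact C \<and> C \<subseteq> U}. emeasure \<nu> C))"

definition metric_measure_space :: "'a::metric_space measure \<Rightarrow> bool" where
  "metric_measure_space \<nu> \<longleftrightarrow>
     locally_compact_space (euclidean :: 'a topology) \<and>
     separable_space (euclidean :: 'a topology) \<and>
     radon_measure \<nu> \<and>
     (\<forall>U. open U \<and> U \<noteq> {} \<longrightarrow> emeasure \<nu> U > 0)"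

section \<open>The space \<open>L\<^sup>2(K; \<nu>)\<close>\<close>

text \<open>
  Elements of \<open>L\<^sup>2\<close> are represented by square integrable functions, and equality in \<open>L\<^sup>2\<close> is
  equality \<open>\<nu>\<close>-almost everywhere. Accordingly a subspace of \<open>L\<^sup>2\<close> is a set of functions that is
  saturated under almost everywhere equality, and an operator maps almost everywhere equal
  functions to almost everywhere equal functions.
\<close>

definition L2 :: "'a measure \<Rightarrow> ('a \<Rightarrow> real) set" where
  "L2 \<nu> = {u. u \<in> borel_measurable \<nu> \<and> integrable \<nu> (\<lambda>x. (u x)\<^sup>2)}"

definition ae_eq :: "'a measure \<Rightarrow> ('a \<Rightarrow> real) \<Rightarrow> ('a \<Rightarrow> real) \<Rightarrow> bool" where
  "ae_eq \<nu> u v \<longleftrightarrow> (AE x in \<nu>. u x = v x)"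

definition l2_inner :: "'a measure \<Rightarrow> ('a \<Rightarrow> real) \<Rightarrow> ('a \<Rightarrow> real) \<Rightarrow> real" where
  "l2_inner \<nu> u v = (\<integral>x. u x * v x \<partial>\<nu>)"

definition l2_norm :: "'a measure \<Rightarrow> ('a \<Rightarrow> real) \<Rightarrow> real" where
  "l2_norm \<nu> u = sqrt (l2_inner \<nu> u u)"

definition l2_subspace :: "'a measure \<Rightarrow> ('a \<Rightarrow> real) set \<Rightarrow> bool" where
  "l2_subspace \<nu> V \<longleftrightarrow>
     V \<subseteq> L2 \<nu> \<and>
     (\<lambda>_. 0) \<in> V \<and>
     (\<forall>u\<in>V. \<forall>v\<in>V. (\<lambda>x. u x + v x) \<in> V) \<and>
     (\<forall>c. \<forall>u\<in>V. (\<lambda>x. c * u x) \<in> V) \<and>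
     (\<forall>u\<in>V. \<forall>v\<in>L2 \<nu>. ae_eq \<nu> u v \<longrightarrow> v \<in> V)"

definition l2_dense :: "'a measure \<Rightarrow> ('a \<Rightarrow> real) set \<Rightarrow> bool" where
  "l2_dense \<nu> V \<longleftrightarrow> (\<forall>u\<in>L2 \<nu>. \<forall>\<epsilon>>0. \<exists>v\<in>V. l2_norm \<nu> (\<lambda>x. u x - v x) < \<epsilon>)"

definition l2_operator ::
  "'a measure \<Rightarrow> ('a \<Rightarrow> real) set \<Rightarrow> (('a \<Rightarrow> real) \<Rightarrow> 'a \<Rightarrow> real) \<Rightarrow> bool" where
  "l2_operator \<nu> D A \<longleftrightarrow>
     l2_subspace \<nu> D \<and>
     (\<forall>u\<in>D. A u \<in> L2 \<nu>) \<and>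
     (\<forall>u\<in>D. \<forall>v\<in>D. ae_eq \<nu> u v \<longrightarrow> ae_eq \<nu> (A u) (A v)) \<and>
     (\<forall>u\<in>D. \<forall>v\<in>D. ae_eq \<nu> (A (\<lambda>x. u x + v x)) (\<lambda>x. A u x + A v x)) \<and>
     (\<forall>c. \<forall>u\<in>D. ae_eq \<nu> (A (\<lambda>x. c * u x)) (\<lambda>x. c * A u x))"

text \<open>The last conjunct says that the graph of the adjoint of \<open>A\<close> is the graph of \<open>A\<close>.\<close>

definition l2_selfadjoint ::
  "'a measure \<Rightarrow> ('a \<Rightarrow> real) set \<Rightarrow> (('a \<Rightarrow> real) \<Rightarrow> 'a \<Rightarrow> real) \<Rightarrow> bool" where
  "l2_selfadjoint \<nu> D A \<longleftrightarrow>
     l2_operator \<nu> D A \<and> l2_dense \<nu> D \<and>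
     (\<forall>u\<in>L2 \<nu>. \<forall>w\<in>L2 \<nu>.
        (\<forall>v\<in>D. l2_inner \<nu> u (A v) = l2_inner \<nu> w v) \<longleftrightarrow> u \<in> D \<and> ae_eq \<nu> w (A u))"

definition l2_bounded_operator ::
  "'a measure \<Rightarrow> ('a \<Rightarrow> real) set \<Rightarrow> (('a \<Rightarrow> real) \<Rightarrow> 'a \<Rightarrow> real) \<Rightarrow> bool" where
  "l2_bounded_operator \<nu> D A \<longleftrightarrow> (\<exists>C. \<forall>u\<in>D. l2_norm \<nu> (A u) \<le> C * l2_norm \<nu> u)"

text \<open>\<open>(D', B)\<close> is the non-negative self-adjoint square root of \<open>-A\<close>, where \<open>A\<close> has domain \<open>D\<close>.\<close>

definition is_sqrt_of_minus ::
  "'a measure \<Rightarrow> ('a \<Rightarrow> real) set \<Rightarrow> (('a \<Rightarrow> real) \<Rightarrow> 'a \<Rightarrow> real)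
     \<Rightarrow> ('a \<Rightarrow> real) set \<Rightarrow> (('a \<Rightarrow> real) \<Rightarrow> 'a \<Rightarrow> real) \<Rightarrow> bool" where
  "is_sqrt_of_minus \<nu> D A D' B \<longleftrightarrow>
     l2_selfadjoint \<nu> D' B \<and>
     (\<forall>u\<in>D'. l2_inner \<nu> (B u) u \<ge> 0) \<and>
     D = {u\<in>D'. B u \<in> D'} \<and>
     (\<forall>u\<in>D. ae_eq \<nu> (B (B u)) (\<lambda>x. - A u x))"

section \<open>Regular Dirichlet forms\<close>

definition form_norm1_sq ::
  "'a measure \<Rightarrow> (('a \<Rightarrow> real) \<Rightarrow> ('a \<Rightarrow> real) \<Rightarrow> real) \<Rightarrow> ('a \<Rightarrow> real) \<Rightarrow> real" where
  "form_norm1_sq \<nu> E u = E u u + l2_inner \<nu> u u"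

definition symmetric_form ::
  "'a measure \<Rightarrow> (('a \<Rightarrow> real) \<Rightarrow> ('a \<Rightarrow> real) \<Rightarrow> real) \<Rightarrow> ('a \<Rightarrow> real) set \<Rightarrow> bool" where
  "symmetric_form \<nu> E F \<longleftrightarrow>
     l2_subspace \<nu> F \<and> l2_dense \<nu> F \<and>
     (\<forall>u\<in>F. \<forall>u'\<in>F. \<forall>v\<in>F. ae_eq \<nu> u u' \<longrightarrow> E u v = E u' v) \<and>
     (\<forall>u\<in>F. \<forall>v\<in>F. E u v = E v u) \<and>
     (\<forall>u\<in>F. \<forall>v\<in>F. \<forall>w\<in>F. E (\<lambda>x. u x + v x) w = E u w + E v w) \<and>
     (\<forall>c. \<forall>u\<in>F. \<forall>v\<in>F. E (\<lambda>x. c * u x) v = c * E u v) \<and>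
     (\<forall>u\<in>F. E u u \<ge> 0)"

definition closed_form ::
  "'a measure \<Rightarrow> (('a \<Rightarrow> real) \<Rightarrow> ('a \<Rightarrow> real) \<Rightarrow> real) \<Rightarrow> ('a \<Rightarrow> real) set \<Rightarrow> bool" where
  "closed_form \<nu> E F \<longleftrightarrow>
     symmetric_form \<nu> E F \<and>
     (\<forall>u :: nat \<Rightarrow> 'a \<Rightarrow> real.
        (\<forall>n. u n \<in> F) \<and>
        (\<forall>\<epsilon>>0. \<exists>N. \<forall>m\<ge>N. \<forall>n\<ge>N. form_norm1_sq \<nu> E (\<lambda>x. u m x - u n x) < \<epsilon>) \<longrightarrow>
        (\<exists>v\<in>F. (\<lambda>n. form_norm1_sq \<nu> E (\<lambda>x. u n x - v x)) \<longlonglongrightarrow> 0))"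

definition dirichlet_form ::
  "'a measure \<Rightarrow> (('a \<Rightarrow> real) \<Rightarrow> ('a \<Rightarrow> real) \<Rightarrow> real) \<Rightarrow> ('a \<Rightarrow> real) set \<Rightarrow> bool" where
  "dirichlet_form \<nu> E F \<longleftrightarrow>
     closed_form \<nu> E F \<and>
     (\<forall>u\<in>F. (\<lambda>x. max 0 (min 1 (u x))) \<in> F \<and>
        E (\<lambda>x. max 0 (min 1 (u x))) (\<lambda>x. max 0 (min 1 (u x))) \<le> E u u)"

definition Cc :: "('a::metric_space \<Rightarrow> real) set" where
  "Cc = {f. continuous_on UNIV f \<and> compact (closure {x. f x \<noteq> 0})}"

definition regular_dirichlet_form ::
  "'a::metric_space measure \<Rightarrow> (('a \<Rightarrow> real) \<Rightarrow> ('a \<Rightarrow> real) \<Rightarrow> real) \<Rightarrow> ('a \<Rightarrow> real) set \<Rightarrow> bool" where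
  "regular_dirichlet_form \<nu> E F \<longleftrightarrow>
     dirichlet_form \<nu> E F \<and>
     (\<forall>u\<in>F. \<forall>\<epsilon>>0. \<exists>\<phi>\<in>F \<inter> Cc. form_norm1_sq \<nu> E (\<lambda>x. u x - \<phi> x) < \<epsilon>) \<and>
     (\<forall>f\<in>Cc. \<forall>\<epsilon>>0. \<exists>\<phi>\<in>F \<inter> Cc. \<forall>x. \<bar>f x - \<phi> x\<bar> < \<epsilon>)"

section \<open>Generator and semigroup\<close>

text \<open>
  \<open>A\<close> with domain \<open>D\<close> is the generator of \<open>(E, F)\<close>: the non-positive definite self-adjoint operator
  whose root \<open>B = \<surd>(-A)\<close> has domain \<open>F\<close> and satisfies \<open>E(u, v) = (B u, B v)\<close>.
\<close>

definition generator_of_form ::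
  "'a measure \<Rightarrow> (('a \<Rightarrow> real) \<Rightarrow> ('a \<Rightarrow> real) \<Rightarrow> real) \<Rightarrow> ('a \<Rightarrow> real) set
     \<Rightarrow> ('a \<Rightarrow> real) set \<Rightarrow> (('a \<Rightarrow> real) \<Rightarrow> 'a \<Rightarrow> real) \<Rightarrow> bool" where
  "generator_of_form \<nu> E F D A \<longleftrightarrow>
     l2_selfadjoint \<nu> D A \<and>
     (\<forall>u\<in>D. l2_inner \<nu> (A u) u \<le> 0) \<and>
     (\<exists>B. is_sqrt_of_minus \<nu> D A F B \<and>
        (\<forall>u\<in>F. \<forall>v\<in>F. E u v = l2_inner \<nu> (B u) (B v)))"

definition markovian_semigroup ::
  "'a measure \<Rightarrow> (real \<Rightarrow> ('a \<Rightarrow> real) \<Rightarrow> 'a \<Rightarrow> real) \<Rightarrow> bool" where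
  "markovian_semigroup \<nu> T \<longleftrightarrow>
     (\<forall>t>0. l2_operator \<nu> (L2 \<nu>) (T t)) \<and>
     (\<forall>t>0. \<forall>u\<in>L2 \<nu>. \<forall>v\<in>L2 \<nu>. l2_inner \<nu> (T t u) v = l2_inner \<nu> u (T t v)) \<and>
     (\<forall>t>0. \<forall>u\<in>L2 \<nu>. l2_norm \<nu> (T t u) \<le> l2_norm \<nu> u) \<and>
     (\<forall>s>0. \<forall>t>0. \<forall>u\<in>L2 \<nu>. ae_eq \<nu> (T (s + t) u) (T s (T t u))) \<and>
     (\<forall>u\<in>L2 \<nu>. ((\<lambda>t. l2_norm \<nu> (\<lambda>x. T t u x - u x)) \<longlongrightarrow> 0) (at_right 0)) \<and>
     (\<forall>t>0. \<forall>u\<in>L2 \<nu>. (AE x in \<nu>. 0 \<le> u x \<and> u x \<le> 1) \<longrightarrow> (AE x in \<nu>. 0 \<le> T t u x \<and> T t u x \<le> 1))"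

text \<open>
  \<open>T\<^sub>t = e\<^sup>t\<^sup>A\<close> for the possibly unbounded operator \<open>A\<close>: the infinitesimal generator of \<open>T\<close>,
  defined on those \<open>u\<close> whose difference quotients converge in \<open>L\<^sup>2\<close>, is \<open>A\<close> with domain \<open>D\<close>.
\<close>

definition infinitesimal_generator ::
  "'a measure \<Rightarrow> (real \<Rightarrow> ('a \<Rightarrow> real) \<Rightarrow> 'a \<Rightarrow> real) \<Rightarrow> ('a \<Rightarrow> real) set
     \<Rightarrow> (('a \<Rightarrow> real) \<Rightarrow> 'a \<Rightarrow> real) \<Rightarrow> bool" where
  "infinitesimal_generator \<nu> T D A \<longleftrightarrow>
     l2_operator \<nu> D A \<and>
     (\<forall>u\<in>L2 \<nu>. \<forall>w\<in>L2 \<nu>.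
        ((\<lambda>t. l2_norm \<nu> (\<lambda>x. (T t u x - u x) / t - w x)) \<longlongrightarrow> 0) (at_right 0)
          \<longleftrightarrow> u \<in> D \<and> ae_eq \<nu> w (A u))"

section \<open>Hunt processes\<close>

text \<open>
  The state space \<open>K\<^sub>\<partial>\<close> is the one-point compactification of \<open>K\<close>, with the cemetery \<open>\<partial>\<close> represented
  by \<open>None\<close>; if \<open>K\<close> is compact, \<open>\<partial>\<close> is an isolated point.
\<close>

definition cemetery_topology :: "'a::metric_space option topology" where
  "cemetery_topology =
     topology (\<lambda>U. open (Some -` U) \<and> (None \<in> U \<longrightarrow> compact (- (Some -` U))))"

lemma openin_cemetery_topology:
  fixes U :: "'a::metric_space option set"
  shows "openin cemetery_topology U \<longleftrightarrow>
    open (Some -` U) \<and> (None \<in> U \<longrightarrow> compact (- (Some -` U)))"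
proof -
  let ?P = "\<lambda>U :: 'a option set. open (Some -` U) \<and> (None \<in> U \<longrightarrow> compact (- (Some -` U)))"
  have "istopology ?P"
    unfolding istopology_def
  proof (intro conjI allI impI)
    fix S T assume S: "?P S" and T: "?P T"
    show "open (Some -` (S \<inter> T))" using S T by (auto simp: vimage_Int)
    assume "None \<in> S \<inter> T"
    then have "compact (- (Some -` S) \<union> - (Some -` T))" using S T by (intro compact_Un) auto
    then show "compact (- (Some -` (S \<inter> T)))" by (simp add: vimage_Int Compl_Int)
  next
    fix \<K> assume K: "\<forall>k\<in>\<K>. ?P k"
    show "open (Some -` \<Union>\<K>)" using K by (auto simp: vimage_Union)
    assume "None \<in> \<Union>\<K>"
    then obtain k where k: "k \<in> \<K>" "None \<in> k" by auto
    have "closed (- (Some -` \<Union>\<K>))" using K by (auto simp: vimage_Union)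
    then have "compact (- (Some -` k) \<inter> - (Some -` \<Union>\<K>))"
      using K k by (intro compact_Int_closed) auto
    moreover have "- (Some -` k) \<inter> - (Some -` \<Union>\<K>) = - (Some -` \<Union>\<K>)" using k by auto
    ultimately show "compact (- (Some -` \<Union>\<K>))" by simp
  qed
  then show ?thesis by (simp add: cemetery_topology_def topology_inverse')
qed

definition cemetery_borel :: "'a::metric_space option measure" where
  "cemetery_borel = sigma UNIV {U. openin cemetery_topology U}"

text \<open>
  A Hunt process with underlying measurable space \<open>W\<close>, laws \<open>P x\<close> for starting points
  \<open>x \<in> K\<^sub>\<partial>\<close>, and paths \<open>X\<close> with time set \<open>[0, \<infinity>]\<close>. The conditions are, in this order:
  measurability of the paths and of the transition function; \<open>X\<^sub>0 = x\<close> almost surely under \<open>P x\<close>;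
  \<open>X\<^sub>\<infinity> = \<partial>\<close> and \<open>\<partial>\<close> is a trap; existence of shifts; right continuity and existence of left limits
  in \<open>K\<^sub>\<partial>\<close>; and existence of a right continuous admissible filtration for which the process is strong
  Markov and quasi-left-continuous. The strong Markov property
  \<open>P\<^sub>x(X\<^sub>\<sigma>\<^sub>+\<^sub>s \<in> B | \<G>\<^sub>\<sigma>) = P\<^bsub>X\<^sub>\<sigma>\<^esub>(X\<^sub>s \<in> B)\<close> is written in integrated form over \<open>\<Lambda> \<in> \<G>\<^sub>\<sigma>\<close>.
\<close>

definition hunt_process ::
  "'w measure \<Rightarrow> ('a::metric_space option \<Rightarrow> 'w measure) \<Rightarrow> (ennreal \<Rightarrow> 'w \<Rightarrow> 'a option) \<Rightarrow> bool" where
  "hunt_process W P X \<longleftrightarrow>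
     (\<forall>x. prob_space (P x) \<and> sets (P x) = sets W) \<and>
     (\<forall>t. X t \<in> measurable W cemetery_borel) \<and>
     (\<forall>t. \<forall>B\<in>sets cemetery_borel.
        (\<lambda>x. emeasure (P x) {\<omega>\<in>space W. X t \<omega> \<in> B}) \<in> borel_measurable cemetery_borel) \<and>
     (\<forall>x. AE \<omega> in P x. X 0 \<omega> = x) \<and>
     (\<forall>\<omega>\<in>space W. X \<infinity> \<omega> = None) \<and>
     (\<forall>\<omega>\<in>space W. \<forall>s t. s \<le> t \<and> X s \<omega> = None \<longrightarrow> X t \<omega> = None) \<and>
     (\<forall>t<\<infinity>. \<exists>\<theta>. \<forall>\<omega>\<in>space W. \<theta> \<omega> \<in> space W \<and> (\<forall>s. X s (\<theta> \<omega>) = X (s + t) \<omega>)) \<and>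
     (\<forall>\<omega>\<in>space W. \<forall>t<\<infinity>. limitin cemetery_topology (\<lambda>s. X s \<omega>) (X t \<omega>) (at_right t)) \<and>
     (\<forall>\<omega>\<in>space W. \<forall>t. 0 < t \<and> t < \<infinity> \<longrightarrow>
        (\<exists>l. limitin cemetery_topology (\<lambda>s. X s \<omega>) l (at_left t))) \<and>
     (\<exists>\<G> :: ennreal \<Rightarrow> 'w measure.
        filtration (space W) \<G> \<and>
        (\<forall>t. sets (\<G> t) \<subseteq> sets W \<and> X t \<in> measurable (\<G> t) cemetery_borel) \<and>
        (\<forall>t<\<infinity>. sets (\<G> t) = (\<Inter>s\<in>{t<..}. sets (\<G> s))) \<and>
        (\<forall>\<sigma> x s. \<forall>B\<in>sets cemetery_borel. stopping_time \<G> \<sigma> \<longrightarrow>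
           (\<forall>\<Lambda>\<in>sets (filtration.pre_sigma (space W) \<G> \<sigma>).
              emeasure (P x) {\<omega>\<in>\<Lambda>. X (\<sigma> \<omega> + s) \<omega> \<in> B} =
              (\<integral>\<^sup>+\<omega>\<in>\<Lambda>. emeasure (P (X (\<sigma> \<omega>) \<omega>)) {\<omega>'\<in>space W. X s \<omega>' \<in> B} \<partial>P x))) \<and>
        (\<forall>(\<sigma> :: nat \<Rightarrow> 'w \<Rightarrow> ennreal) x.
           (\<forall>n. stopping_time \<G> (\<sigma> n)) \<and> (\<forall>\<omega>\<in>space W. incseq (\<lambda>n. \<sigma> n \<omega>)) \<longrightarrow>
           (AE \<omega> in P x. (SUP n. \<sigma> n \<omega>) < \<infinity> \<longrightarrow>
              limitin cemetery_topology (\<lambda>n. X (\<sigma> n \<omega>) \<omega>) (X (SUP n. \<sigma> n \<omega>) \<omega>) sequentially)))"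

text \<open>
  The \<open>L\<^sup>2\<close>-semigroup \<open>T\<close> corresponds to the process \<open>(P, X)\<close>: \<open>x \<mapsto> E\<^sub>x u(X\<^sub>t)\<close>, with \<open>u(\<partial>) = 0\<close>,
  is a version of \<open>T\<^sub>t u\<close>.
\<close>

definition process_has_semigroup ::
  "'a measure \<Rightarrow> ('a option \<Rightarrow> 'w measure) \<Rightarrow> (ennreal \<Rightarrow> 'w \<Rightarrow> 'a option)
     \<Rightarrow> (real \<Rightarrow> ('a \<Rightarrow> real) \<Rightarrow> 'a \<Rightarrow> real) \<Rightarrow> bool" where
  "process_has_semigroup \<nu> P X T \<longleftrightarrow>
     (\<forall>t>0. \<forall>u\<in>L2 \<nu>. AE x in \<nu>.
        T t u x = (\<integral>\<omega>. (case X (ennreal t) \<omega> of None \<Rightarrow> 0 | Some y \<Rightarrow> u y) \<partial>P (Some x)))"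

section \<open>Subordination\<close>

definition levy_process :: "'b measure \<Rightarrow> (real \<Rightarrow> 'b \<Rightarrow> real) \<Rightarrow> bool" where
  "levy_process M \<xi> \<longleftrightarrow>
     prob_space M \<and>
     (\<forall>t\<ge>0. \<xi> t \<in> borel_measurable M) \<and>
     (AE \<omega> in M. \<xi> 0 \<omega> = 0) \<and>
     (\<forall>(n :: nat) (\<tau> :: nat \<Rightarrow> real). 0 \<le> \<tau> 0 \<and> (\<forall>i<n. \<tau> i \<le> \<tau> (Suc i)) \<longrightarrow>
        prob_space.indep_vars M (\<lambda>_. borel) (\<lambda>i \<omega>. \<xi> (\<tau> (Suc i)) \<omega> - \<xi> (\<tau> i) \<omega>) {..<n}) \<and>
     (\<forall>s\<ge>0. \<forall>t\<ge>0. distr M borel (\<lambda>\<omega>. \<xi> (s + t) \<omega> - \<xi> s \<omega>) = distr M borel (\<xi> t)) \<and>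
     (AE \<omega> in M. (\<forall>t\<ge>0. ((\<lambda>s. \<xi> s \<omega>) \<longlongrightarrow> \<xi> t \<omega>) (at_right t)) \<and>
        (\<forall>t>0. \<exists>l. ((\<lambda>s. \<xi> s \<omega>) \<longlongrightarrow> l) (at_left t)))"

definition stable_subordinator :: "real \<Rightarrow> 'b measure \<Rightarrow> (real \<Rightarrow> 'b \<Rightarrow> real) \<Rightarrow> bool" where
  "stable_subordinator \<delta> M \<xi> \<longleftrightarrow>
     levy_process M \<xi> \<and>
     (\<forall>t\<ge>0. \<forall>s\<ge>0. (\<integral>\<omega>. exp (- s * \<xi> t \<omega>) \<partial>M) = exp (- t * s powr \<delta>))"

text \<open>\<open>\<eta> t\<close> is the density on \<open>(0, \<infinity>)\<close> of the law of \<open>\<xi> t\<close>; its values on \<open>(-\<infinity>, 0]\<close> are irrelevant.\<close>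

definition density_on_positive ::
  "'b measure \<Rightarrow> (real \<Rightarrow> 'b \<Rightarrow> real) \<Rightarrow> (real \<Rightarrow> real \<Rightarrow> real) \<Rightarrow> bool" where
  "density_on_positive M \<xi> \<eta> \<longleftrightarrow>
     (\<forall>t>0. (\<forall>s>0. \<eta> t s \<ge> 0) \<and>
        distributed M lborel (\<xi> t) (\<lambda>s. ennreal (indicator {0<..} s * \<eta> t s)))"

text \<open>
  The subordinated process \<open>X\<^bsub>\<xi>(t)\<^esub>\<close> lives on the product of the two sample spaces with laws
  \<open>P\<^sub>x \<otimes> M\<close>, so that \<open>\<xi>\<close> is independent of \<open>X\<close>.
\<close>

definition subordinated_law ::
  "('a option \<Rightarrow> 'w measure) \<Rightarrow> 'b measure \<Rightarrow> 'a option \<Rightarrow> ('w \<times> 'b) measure" where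
  "subordinated_law P M x = P x \<Otimes>\<^sub>M M"

definition subordinated_process ::
  "(ennreal \<Rightarrow> 'w \<Rightarrow> 'a option) \<Rightarrow> (real \<Rightarrow> 'b \<Rightarrow> real) \<Rightarrow> ennreal \<Rightarrow> 'w \<times> 'b \<Rightarrow> 'a option" where
  "subordinated_process X \<xi> t = (\<lambda>(\<omega>, \<omega>').
     if t = \<infinity> then None else X (ennreal (\<xi> (enn2real t) \<omega>')) \<omega>)"

text \<open>
  \<open>T\<^sub>t\<^sup>(\<^sup>\<delta>\<^sup>) u\<close> is the \<open>L\<^sup>2\<close>-valued integral of \<open>T\<^sub>s u\<close> against \<open>\<eta> t s ds\<close>. Vector-valued integration is
  understood weakly, i.e. by testing with all \<open>v \<in> L\<^sup>2\<close>; as \<open>s \<mapsto> T\<^sub>s u\<close> is bounded and continuous,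
  this agrees with the Bochner integral.
\<close>

definition subordinated_semigroup ::
  "'a measure \<Rightarrow> (real \<Rightarrow> ('a \<Rightarrow> real) \<Rightarrow> 'a \<Rightarrow> real) \<Rightarrow> (real \<Rightarrow> real \<Rightarrow> real)
     \<Rightarrow> (real \<Rightarrow> ('a \<Rightarrow> real) \<Rightarrow> 'a \<Rightarrow> real) \<Rightarrow> bool" where
  "subordinated_semigroup \<nu> T \<eta> T' \<longleftrightarrow>
     (\<forall>t>0. \<forall>u\<in>L2 \<nu>. T' t u \<in> L2 \<nu> \<and>
        (\<forall>v\<in>L2 \<nu>. l2_inner \<nu> (T' t u) v =
           (LINT s:{0<..}|lborel. l2_inner \<nu> (T s u) v * \<eta> t s)))"

section \<open>The form of a semigroup\<close>

definition semigroup_energy ::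
  "'a measure \<Rightarrow> (real \<Rightarrow> ('a \<Rightarrow> real) \<Rightarrow> 'a \<Rightarrow> real) \<Rightarrow> ('a \<Rightarrow> real) \<Rightarrow> ereal" where
  "semigroup_energy \<nu> T u =
     Lim (at_right 0) (\<lambda>t. ereal (1 / t * l2_inner \<nu> (\<lambda>x. u x - T t u x) u))"

definition semigroup_form_domain ::
  "'a measure \<Rightarrow> (real \<Rightarrow> ('a \<Rightarrow> real) \<Rightarrow> 'a \<Rightarrow> real) \<Rightarrow> ('a \<Rightarrow> real) set" where
  "semigroup_form_domain \<nu> T = {u \<in> L2 \<nu>. semigroup_energy \<nu> T u < \<infinity>}"

end

theory Submission
  imports Defs
begin

text \<open>
  For \<open>u\<close> in \<open>L\<^sup>2\<close> put \<open>\<psi>(s) = (u - T\<^sub>s u, u)\<close>. This function is nonnegative, increasing and subadditive,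
  and \<open>\<surd>\<psi>\<close> is a seminorm in \<open>u\<close>. Hence \<open>\<Psi>(t) = (u - T\<^sub>t\<^sup>(\<^sup>\<delta>\<^sup>) u, u)\<close>, the mean of \<open>\<psi>\<close> at the time \<open>\<xi>\<^sub>t\<close> of the
  subordinator, is subadditive in \<open>t\<close>, so that \<open>\<Psi>(t) / t\<close> has a limit at \<open>0\<close>, finite as soon as
  \<open>\<Psi>(t) \<le> C t\<close>. The Laplace transform of \<open>\<xi>\<^sub>t\<close> turns a bound \<open>\<psi>(s) \<le> K min(1, c s)\<close> into
  \<open>\<Psi>(t) \<le> 2 K c\<^sup>\<delta> t\<close>; with the inequality \<open>\<psi>(s) \<le> s E(u, u)\<close> for \<open>u\<close> in \<open>F\<close> this gives the inclusion.

  If \<open>A\<close> is bounded, closedness of the form gives \<open>F = L\<^sup>2\<close>. If \<open>A\<close> is unbounded, there are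
  \<open>v\<close> in the domain of \<open>A\<close> with \<open>c = E(v, v) / \<parallel>v\<parallel>\<^sup>2\<close> arbitrarily large. Scaled to energy \<open>k\<^sup>2\<close>, such a
  vector has \<open>L\<^sup>2\<close> norm squared \<open>k\<^sup>2 / c\<close> and \<open>\<delta>\<close>-energy of order \<open>k\<^sup>2 c\<^sup>\<delta>\<^sup>-\<^sup>1\<close>, both as small as desired.
  A gliding hump sum of such vectors with suitable signs lies in every \<open>F\<^sup>(\<^sup>\<delta>\<^sup>)\<close> but has infinite energy.
\<close>

section \<open>The space \<open>L\<^sup>2\<close>\<close>

lemma L2_borel: "u \<in> L2 \<nu> \<Longrightarrow> u \<in> borel_measurable \<nu>"
  by (simp add: L2_def)

lemma L2_integrable_mult:
  assumes "u \<in> L2 \<nu>" "v \<in> L2 \<nu>"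
  shows "integrable \<nu> (\<lambda>x. u x * v x)"
proof (rule Bochner_Integration.integrable_bound)
  show "integrable \<nu> (\<lambda>x. (u x)\<^sup>2 + (v x)\<^sup>2)"
    using assms by (auto simp: L2_def)
  show "(\<lambda>x. u x * v x) \<in> borel_measurable \<nu>"
    using assms by (auto simp: L2_def)
  show "AE x in \<nu>. norm (u x * v x) \<le> norm ((u x)\<^sup>2 + (v x)\<^sup>2)"
  proof (intro AE_I2)
    fix x
    have "0 \<le> (\<bar>u x\<bar> - \<bar>v x\<bar>)\<^sup>2" "0 \<le> (u x)\<^sup>2 + (v x)\<^sup>2" by auto
    then have "2 * (\<bar>u x\<bar> * \<bar>v x\<bar>) \<le> (u x)\<^sup>2 + (v x)\<^sup>2" "0 \<le> \<bar>u x\<bar> * \<bar>v x\<bar>"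
      by (auto simp: power2_diff)
    then have "\<bar>u x\<bar> * \<bar>v x\<bar> \<le> (u x)\<^sup>2 + (v x)\<^sup>2" by linarith
    then show "norm (u x * v x) \<le> norm ((u x)\<^sup>2 + (v x)\<^sup>2)"
      by (simp add: abs_mult)
  qed
qed

lemma L2_zero [simp]: "(\<lambda>_. 0) \<in> L2 \<nu>"
  by (simp add: L2_def)

lemma L2_add [intro]: "u \<in> L2 \<nu> \<Longrightarrow> v \<in> L2 \<nu> \<Longrightarrow> (\<lambda>x. u x + v x) \<in> L2 \<nu>"
  using L2_integrable_mult[of u \<nu> v] by (auto simp: L2_def power2_sum mult.assoc)

lemma L2_scale [intro]: "u \<in> L2 \<nu> \<Longrightarrow> (\<lambda>x. c * u x) \<in> L2 \<nu>"
  by (auto simp: L2_def power_mult_distrib)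

lemma L2_minus [intro]: "u \<in> L2 \<nu> \<Longrightarrow> (\<lambda>x. - u x) \<in> L2 \<nu>"
  using L2_scale[of u \<nu> "-1"] by simp

lemma L2_diff [intro]: "u \<in> L2 \<nu> \<Longrightarrow> v \<in> L2 \<nu> \<Longrightarrow> (\<lambda>x. u x - v x) \<in> L2 \<nu>"
  using L2_add[of u \<nu> "\<lambda>x. - v x"] by auto

lemma L2_divide [intro]: "u \<in> L2 \<nu> \<Longrightarrow> (\<lambda>x. u x / c) \<in> L2 \<nu>"
  using L2_scale[of u \<nu> "1 / c"] by simp

lemma l2_inner_commute: "l2_inner \<nu> u v = l2_inner \<nu> v u"
  by (simp add: l2_inner_def mult.commute)

lemma l2_inner_add_left:
  "u \<in> L2 \<nu> \<Longrightarrow> v \<in> L2 \<nu> \<Longrightarrow> w \<in> L2 \<nu> \<Longrightarrow>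
    l2_inner \<nu> (\<lambda>x. u x + v x) w = l2_inner \<nu> u w + l2_inner \<nu> v w"
  by (simp add: l2_inner_def distrib_right L2_integrable_mult)

lemma l2_inner_diff_left:
  "u \<in> L2 \<nu> \<Longrightarrow> v \<in> L2 \<nu> \<Longrightarrow> w \<in> L2 \<nu> \<Longrightarrow>
    l2_inner \<nu> (\<lambda>x. u x - v x) w = l2_inner \<nu> u w - l2_inner \<nu> v w"
  by (simp add: l2_inner_def left_diff_distrib L2_integrable_mult)

lemma l2_inner_scale_left: "l2_inner \<nu> (\<lambda>x. c * u x) w = c * l2_inner \<nu> u w"
  by (simp add: l2_inner_def mult.assoc)

lemma l2_inner_minus_left: "l2_inner \<nu> (\<lambda>x. - u x) w = - l2_inner \<nu> u w"
  using l2_inner_scale_left[of \<nu> "-1" u w] by simp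

lemma l2_inner_divide_left: "l2_inner \<nu> (\<lambda>x. u x / c) w = l2_inner \<nu> u w / c"
  using l2_inner_scale_left[of \<nu> "1 / c" u w] by simp

lemma l2_inner_add_right:
  "u \<in> L2 \<nu> \<Longrightarrow> v \<in> L2 \<nu> \<Longrightarrow> w \<in> L2 \<nu> \<Longrightarrow>
    l2_inner \<nu> w (\<lambda>x. u x + v x) = l2_inner \<nu> w u + l2_inner \<nu> w v"
  by (simp add: l2_inner_commute[of _ w] l2_inner_add_left)

lemma l2_inner_diff_right:
  "u \<in> L2 \<nu> \<Longrightarrow> v \<in> L2 \<nu> \<Longrightarrow> w \<in> L2 \<nu> \<Longrightarrow>
    l2_inner \<nu> w (\<lambda>x. u x - v x) = l2_inner \<nu> w u - l2_inner \<nu> w v"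
  by (simp add: l2_inner_commute[of _ w] l2_inner_diff_left)

lemma l2_inner_scale_right: "l2_inner \<nu> w (\<lambda>x. c * u x) = c * l2_inner \<nu> w u"
  by (simp add: l2_inner_commute[of _ w] l2_inner_scale_left)

lemma l2_inner_minus_right: "l2_inner \<nu> w (\<lambda>x. - u x) = - l2_inner \<nu> w u"
  by (simp add: l2_inner_commute[of _ w] l2_inner_minus_left)

lemma ae_eq_refl [simp]: "ae_eq \<nu> u u"
  by (simp add: ae_eq_def)

lemma l2_inner_cong:
  assumes "u \<in> L2 \<nu>" "u' \<in> L2 \<nu>" "v \<in> L2 \<nu>" "v' \<in> L2 \<nu>" "ae_eq \<nu> u u'" "ae_eq \<nu> v v'"
  shows "l2_inner \<nu> u v = l2_inner \<nu> u' v'"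
  unfolding l2_inner_def
proof (rule integral_cong_AE)
  show "(\<lambda>x. u x * v x) \<in> borel_measurable \<nu>" "(\<lambda>x. u' x * v' x) \<in> borel_measurable \<nu>"
    using assms by (auto dest!: L2_borel)
  show "AE x in \<nu>. u x * v x = u' x * v' x"
    using assms(5,6) unfolding ae_eq_def by eventually_elim simp
qed

lemma l2_inner_self_nonneg [simp]: "0 \<le> l2_inner \<nu> u u"
  by (simp add: l2_inner_def)

lemma l2_norm_nonneg [simp]: "0 \<le> l2_norm \<nu> u"
  by (simp add: l2_norm_def)

lemma l2_norm_power2: "(l2_norm \<nu> u)\<^sup>2 = l2_inner \<nu> u u"
  by (simp add: l2_norm_def)

lemma l2_norm_cong:
  "u \<in> L2 \<nu> \<Longrightarrow> u' \<in> L2 \<nu> \<Longrightarrow> ae_eq \<nu> u u' \<Longrightarrow> l2_norm \<nu> u = l2_norm \<nu> u'"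
  unfolding l2_norm_def by (metis l2_inner_cong)

lemma l2_norm_zero [simp]: "l2_norm \<nu> (\<lambda>_. 0) = 0"
  by (simp add: l2_norm_def l2_inner_def)

lemma l2_norm_scale: "l2_norm \<nu> (\<lambda>x. c * u x) = \<bar>c\<bar> * l2_norm \<nu> u"
  by (simp add: l2_norm_def l2_inner_scale_left l2_inner_scale_right real_sqrt_mult
      flip: power2_eq_square mult.assoc)

lemma l2_norm_minus: "l2_norm \<nu> (\<lambda>x. - u x) = l2_norm \<nu> u"
  using l2_norm_scale[of \<nu> "-1" u] by simp

lemma l2_norm_minus_commute: "l2_norm \<nu> (\<lambda>x. u x - v x) = l2_norm \<nu> (\<lambda>x. v x - u x)"
  using l2_norm_minus[of \<nu> "\<lambda>x. u x - v x"] by simp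

section \<open>Cauchy-Schwarz and Minkowski inequalities\<close>

lemma power2_le_mult_if_quadratic_nonneg:
  fixes a b c :: real
  assumes nonneg: "\<And>r. 0 \<le> a + 2 * r * b + r\<^sup>2 * c" and "0 \<le> c"
  shows "b\<^sup>2 \<le> a * c"
proof (cases "c = 0")
  case True
  have "b = 0"
  proof (rule ccontr)
    assume "b \<noteq> 0"
    \<comment> \<open>For c = 0 the polynomial is affine in r; this r is the point where it takes
      the value -1.\<close>
    then have "a + 2 * (- (a + 1) / (2 * b)) * b = -1" by (simp add: field_simps)
    then show False using nonneg[of "- (a + 1) / (2 * b)"] True by simp
  qed
  then show ?thesis using True by simp
next
  case False
  then have "0 < c" using \<open>0 \<le> c\<close> by simp
  \<comment> \<open>The quadratic is evaluated at its minimum r = -b / c.\<close>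
  have "0 \<le> a - b\<^sup>2 / c"
    using nonneg[of "- b / c"] \<open>0 < c\<close> by (simp add: power2_eq_square field_simps)
  then show ?thesis using \<open>0 < c\<close> by (simp add: field_simps)
qed

text \<open>The passage from Cauchy-Schwarz to Minkowski for any semidefinite quadratic form: b is
  at most sqrt a * sqrt c. It serves the L2 norm and \<open>dissip\<close> alike.\<close>

lemma sqrt_quadratic_le:
  fixes a b c :: real
  assumes "b\<^sup>2 \<le> a * c" "0 \<le> a" "0 \<le> c"
  shows "sqrt (a + 2 * b + c) \<le> sqrt a + sqrt c"
proof (rule real_le_lsqrt)
  show "0 \<le> sqrt a + sqrt c" using assms by simp
  have "b \<le> sqrt (a * c)" using assms(1) by (rule real_le_rsqrt)
  then show "a + 2 * b + c \<le> (sqrt a + sqrt c)\<^sup>2"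
    using assms by (simp add: power2_sum real_sqrt_mult)
qed

lemma l2_inner_add_scale:
  assumes "u \<in> L2 \<nu>" "v \<in> L2 \<nu>"
  shows "l2_inner \<nu> (\<lambda>x. u x + r * v x) (\<lambda>x. u x + r * v x) =
    l2_inner \<nu> u u + 2 * r * l2_inner \<nu> u v + r\<^sup>2 * l2_inner \<nu> v v"
  using assms
  by (simp add: l2_inner_add_left l2_inner_add_right l2_inner_scale_left l2_inner_scale_right
      L2_add L2_scale l2_inner_commute[of \<nu> v u] algebra_simps power2_eq_square)

lemma l2_Cauchy_Schwarz:
  assumes "u \<in> L2 \<nu>" "v \<in> L2 \<nu>"
  shows "\<bar>l2_inner \<nu> u v\<bar> \<le> l2_norm \<nu> u * l2_norm \<nu> v"
proof -
  have "(l2_inner \<nu> u v)\<^sup>2 \<le> l2_inner \<nu> u u * l2_inner \<nu> v v"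
    by (rule power2_le_mult_if_quadratic_nonneg)
      (simp_all flip: l2_inner_add_scale[OF assms])
  then show ?thesis
    unfolding l2_norm_def real_sqrt_mult[symmetric] by (intro real_le_rsqrt) simp
qed

lemma l2_norm_triangle:
  assumes "u \<in> L2 \<nu>" "v \<in> L2 \<nu>"
  shows "l2_norm \<nu> (\<lambda>x. u x + v x) \<le> l2_norm \<nu> u + l2_norm \<nu> v"
proof -
  have "(l2_inner \<nu> u v)\<^sup>2 \<le> l2_inner \<nu> u u * l2_inner \<nu> v v"
    by (rule power2_le_mult_if_quadratic_nonneg)
      (simp_all flip: l2_inner_add_scale[OF assms])
  from sqrt_quadratic_le[OF this] show ?thesis
    unfolding l2_norm_def using l2_inner_add_scale[OF assms, of 1] by simp
qed

lemma l2_norm_triangle_diff: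
  assumes "u \<in> L2 \<nu>" "v \<in> L2 \<nu>" "w \<in> L2 \<nu>"
  shows "l2_norm \<nu> (\<lambda>x. u x - w x) \<le> l2_norm \<nu> (\<lambda>x. u x - v x) + l2_norm \<nu> (\<lambda>x. v x - w x)"
  using l2_norm_triangle[of "\<lambda>x. u x - v x" \<nu> "\<lambda>x. v x - w x"] assms by (simp add: L2_diff)

lemma l2_norm_mono:
  assumes "u \<in> borel_measurable \<nu>" "v \<in> L2 \<nu>" "\<And>x. 0 \<le> u x" "AE x in \<nu>. u x \<le> v x"
  shows "u \<in> L2 \<nu>" "l2_norm \<nu> u \<le> l2_norm \<nu> v"
proof -
  have *: "AE x in \<nu>. (u x)\<^sup>2 \<le> (v x)\<^sup>2"
    using assms(4) by eventually_elim (simp add: power_mono assms(3))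
  show u: "u \<in> L2 \<nu>"
    unfolding L2_def
    using assms(1) Bochner_Integration.integrable_bound[of \<nu> "\<lambda>x. (v x)\<^sup>2" "\<lambda>x. (u x)\<^sup>2"] assms(2) *
    by (simp add: L2_def)
  show "l2_norm \<nu> u \<le> l2_norm \<nu> v"
    unfolding l2_norm_def l2_inner_def real_sqrt_le_iff
    using u assms(2) * by (intro integral_mono_AE L2_integrable_mult) (auto simp: power2_eq_square)
qed

lemma ae_eq_if_l2_norm_diff_zero:
  assumes "u \<in> L2 \<nu>" "v \<in> L2 \<nu>" "l2_norm \<nu> (\<lambda>x. u x - v x) = 0"
  shows "ae_eq \<nu> u v"
proof -
  have "(\<integral>x. (u x - v x) * (u x - v x) \<partial>\<nu>) = 0"
    using assms(3) by (simp add: l2_norm_def l2_inner_def)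
  then have "AE x in \<nu>. (u x - v x) * (u x - v x) = 0"
    by (subst (asm) integral_nonneg_eq_0_iff_AE) (auto intro!: L2_integrable_mult L2_diff assms)
  then show ?thesis by (simp add: ae_eq_def)
qed

section \<open>Limits and dense subsets in L2\<close>

lemma tendsto_l2_inner:
  assumes "eventually (\<lambda>n. f n \<in> L2 \<nu>) G" "u \<in> L2 \<nu>" "v \<in> L2 \<nu>"
    and "((\<lambda>n. l2_norm \<nu> (\<lambda>x. f n x - u x)) \<longlongrightarrow> 0) G"
  shows "((\<lambda>n. l2_inner \<nu> (f n) v) \<longlongrightarrow> l2_inner \<nu> u v) G"
proof -
  have "((\<lambda>n. l2_norm \<nu> (\<lambda>x. f n x - u x) * l2_norm \<nu> v) \<longlongrightarrow> 0) G"
    using assms(4) by (rule tendsto_mult_left_zero)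
  moreover have "eventually (\<lambda>n. norm (l2_inner \<nu> (f n) v - l2_inner \<nu> u v) \<le>
      l2_norm \<nu> (\<lambda>x. f n x - u x) * l2_norm \<nu> v) G"
    using assms(1)
  proof eventually_elim
    case (elim n)
    then show ?case
      using l2_Cauchy_Schwarz[of "\<lambda>x. f n x - u x" \<nu> v] assms(2,3)
      by (simp add: l2_inner_diff_left L2_diff)
  qed
  ultimately have "((\<lambda>n. l2_inner \<nu> (f n) v - l2_inner \<nu> u v) \<longlongrightarrow> 0) G"
    by (rule Lim_null_comparison[rotated])
  then show ?thesis by (simp add: LIM_zero_iff)
qed

lemma l2_dense_sequence:
  assumes "l2_dense \<nu> V" "u \<in> L2 \<nu>"
  obtains f where "\<And>n. f n \<in> V" "(\<lambda>n. l2_norm \<nu> (\<lambda>x. f n x - u x)) \<longlonglongrightarrow> 0"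
proof -
  have "\<forall>n. \<exists>v\<in>V. l2_norm \<nu> (\<lambda>x. u x - v x) < inverse (real (Suc n))"
    using assms by (auto simp: l2_dense_def simp del: of_nat_Suc)
  then obtain f where f: "\<And>n. f n \<in> V" "\<And>n. l2_norm \<nu> (\<lambda>x. u x - f n x) < inverse (real (Suc n))"
    by metis
  have "(\<lambda>n. l2_norm \<nu> (\<lambda>x. f n x - u x)) \<longlonglongrightarrow> 0"
    using f(2) by (intro Lim_null_comparison[OF _ LIMSEQ_inverse_real_of_nat] always_eventually allI)
      (simp add: l2_norm_minus_commute[of \<nu> _ u] less_imp_le del: of_nat_Suc)
  with f(1) show ?thesis by (rule that)
qed

section \<open>Completeness of L2 along geometrically controlled sequences\<close>

lemma l2_norm_diff_le_geometric:
  assumes S: "\<And>n. S n \<in> L2 \<nu>"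
    and step: "\<And>n. l2_norm \<nu> (\<lambda>x. S (Suc n) x - S n x) \<le> \<rho> n"
    and \<rho>: "\<And>n. 2 * \<rho> (Suc n) \<le> \<rho> n"
  shows "l2_norm \<nu> (\<lambda>x. S (n + k) x - S n x) \<le> 2 * \<rho> n"
proof -
  have nonneg: "0 \<le> \<rho> n" for n using step[of n] l2_norm_nonneg order_trans by blast
  \<comment> \<open>The subtracted term closes the induction: halving makes its drop from one k to
    the next at least \<rho> (n + k), which pays for the new increment.\<close>
  have "l2_norm \<nu> (\<lambda>x. S (n + k) x - S n x) \<le> 2 * \<rho> n - 2 * \<rho> (n + k)"
  proof (induction k)
    case (Suc k)
    have "l2_norm \<nu> (\<lambda>x. S (n + Suc k) x - S n x) \<le>
        l2_norm \<nu> (\<lambda>x. S (Suc (n + k)) x - S (n + k) x) + l2_norm \<nu> (\<lambda>x. S (n + k) x - S n x)"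
      using l2_norm_triangle_diff[where u = "S (n + Suc k)" and v = "S (n + k)" and w = "S n"] S
      by simp
    then show ?case using Suc step[of "n + k"] \<rho>[of "n + k"] by simp
  qed simp
  then show ?thesis using nonneg[of "n + k"] by linarith
qed

lemma nn_integral_power2_eq_l2_norm:
  assumes "u \<in> L2 \<nu>"
  shows "(\<integral>\<^sup>+x. ennreal ((u x)\<^sup>2) \<partial>\<nu>) = ennreal ((l2_norm \<nu> u)\<^sup>2)"
  unfolding l2_norm_power2 l2_inner_def using assms
  by (subst nn_integral_eq_integral) (auto simp: L2_def power2_eq_square)

lemma L2_if_nn_integral_power2_le:
  assumes "u \<in> borel_measurable \<nu>" "(\<integral>\<^sup>+x. ennreal ((u x)\<^sup>2) \<partial>\<nu>) \<le> ennreal (c\<^sup>2)" "0 \<le> c"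
  shows "u \<in> L2 \<nu>" "l2_norm \<nu> u \<le> c"
proof -
  show u: "u \<in> L2 \<nu>"
    unfolding L2_def using assms
    by (auto intro!: integrableI_nonneg simp: less_top[symmetric] top_unique intro: order.strict_trans1)
  show "l2_norm \<nu> u \<le> c"
    using assms(2,3) nn_integral_power2_eq_l2_norm[OF u] by (auto intro: power2_le_imp_le)
qed

lemma l2_Fatou:
  assumes f: "\<And>n. f n \<in> L2 \<nu>" "\<And>n. l2_norm \<nu> (f n) \<le> c"
    and u: "u \<in> borel_measurable \<nu>" "AE x in \<nu>. (\<lambda>n. f n x) \<longlonglongrightarrow> u x"
  shows "u \<in> L2 \<nu>" "l2_norm \<nu> u \<le> c"
proof -
  have "0 \<le> c" using f(2)[of 0] l2_norm_nonneg order_trans by blast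
  have "(\<integral>\<^sup>+x. ennreal ((u x)\<^sup>2) \<partial>\<nu>) = (\<integral>\<^sup>+x. liminf (\<lambda>n. ennreal ((f n x)\<^sup>2)) \<partial>\<nu>)"
  proof (rule nn_integral_cong_AE)
    show "AE x in \<nu>. ennreal ((u x)\<^sup>2) = liminf (\<lambda>n. ennreal ((f n x)\<^sup>2))"
      using u(2)
    proof eventually_elim
      case (elim x)
      then have "(\<lambda>n. ennreal ((f n x)\<^sup>2)) \<longlonglongrightarrow> ennreal ((u x)\<^sup>2)"
        by (intro tendsto_ennrealI tendsto_power)
      from lim_imp_Liminf[OF _ this] show ?case by simp
    qed
  qed
  also have "\<dots> \<le> liminf (\<lambda>n. \<integral>\<^sup>+x. ennreal ((f n x)\<^sup>2) \<partial>\<nu>)"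
    using L2_borel[OF f(1)] by (intro nn_integral_liminf) simp
  also have "\<dots> \<le> liminf (\<lambda>n. ennreal (c\<^sup>2))"
    using f by (intro Liminf_mono always_eventually allI)
      (simp add: nn_integral_power2_eq_l2_norm ennreal_leI power_mono)
  finally have "(\<integral>\<^sup>+x. ennreal ((u x)\<^sup>2) \<partial>\<nu>) \<le> ennreal (c\<^sup>2)"
    by (simp add: Liminf_const)
  from L2_if_nn_integral_power2_le[OF u(1) this \<open>0 \<le> c\<close>]
  show "u \<in> L2 \<nu>" "l2_norm \<nu> u \<le> c" by auto
qed

text \<open>Completeness with an explicit rate: the gliding hump has to compare the distance from
  its limit to stage n with the scale fixed at that stage. The limit is taken pointwise, and the
  rate comes from Fatou's lemma.\<close>

lemma L2_limit_of_geometric: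
  assumes S: "\<And>n. S n \<in> L2 \<nu>"
    and step: "\<And>n. l2_norm \<nu> (\<lambda>x. S (Suc n) x - S n x) \<le> \<rho> n"
    and \<rho>: "\<And>n. 2 * \<rho> (Suc n) \<le> \<rho> n"
  obtains u where "u \<in> L2 \<nu>" "\<And>n. l2_norm \<nu> (\<lambda>x. u x - S n x) \<le> 2 * \<rho> n"
proof -
  define f where "f k x = S (Suc k) x - S k x" for k x
  have f: "f k \<in> L2 \<nu>" for k unfolding f_def by (intro L2_diff S)
  have [measurable]: "S k \<in> borel_measurable \<nu>" "f k \<in> borel_measurable \<nu>" for k
    using S f L2_borel by blast+
  have nonneg: "0 \<le> \<rho> n" for n using step[of n] l2_norm_nonneg order_trans by blast
  have \<rho>_le: "\<rho> k \<le> \<rho> 0 * (1 / 2) ^ k" for k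
  proof (induction k)
    case (Suc k)
    then show ?case using \<rho>[of k] by simp
  qed simp
  \<comment> \<open>The weights \<open>2\<^sup>k\<close> leave the series of integrals convergent, and the weighted squares
    dominate the increments themselves up to the summable sequence \<open>2\<^sup>-\<^sup>k\<close>.\<close>
  have "(\<integral>\<^sup>+x. (\<Sum>k. ennreal (2 ^ k * (f k x)\<^sup>2)) \<partial>\<nu>) =
      (\<Sum>k. \<integral>\<^sup>+x. ennreal (2 ^ k * (f k x)\<^sup>2) \<partial>\<nu>)"
    by (intro nn_integral_suminf) simp
  also have "\<dots> = (\<Sum>k. ennreal (2 ^ k * (l2_norm \<nu> (f k))\<^sup>2))"
    by (simp add: ennreal_mult nn_integral_cmult nn_integral_power2_eq_l2_norm[OF f])
  also have "\<dots> \<le> (\<Sum>k. ennreal ((\<rho> 0)\<^sup>2 * (1 / 2) ^ k))"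
  proof (intro suminf_le ennreal_leI summableI)
    fix k
    have "l2_norm \<nu> (f k) \<le> \<rho> 0 * (1 / 2) ^ k"
      using step[of k] \<rho>_le[of k] by (simp add: f_def[abs_def])
    then have "(l2_norm \<nu> (f k))\<^sup>2 \<le> (\<rho> 0 * (1 / 2) ^ k)\<^sup>2" by (intro power_mono) auto
    then have "2 ^ k * (l2_norm \<nu> (f k))\<^sup>2 \<le> 2 ^ k * (\<rho> 0 * (1 / 2) ^ k)\<^sup>2"
      by (intro mult_left_mono) auto
    also have "\<dots> = (\<rho> 0)\<^sup>2 * (1 / 2) ^ k"
      by (simp add: power_mult_distrib power2_eq_square power_divide)
    finally show "2 ^ k * (l2_norm \<nu> (f k))\<^sup>2 \<le> (\<rho> 0)\<^sup>2 * (1 / 2) ^ k" .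
  qed
  also have "\<dots> < \<infinity>"
    unfolding infinity_ennreal_def less_top[symmetric]
    by (intro ennreal_suminf_neq_top summable_mult summable_geometric) auto
  finally have "(\<integral>\<^sup>+x. (\<Sum>k. ennreal (2 ^ k * (f k x)\<^sup>2)) \<partial>\<nu>) \<noteq> \<infinity>"
    by simp
  then have "AE x in \<nu>. (\<Sum>k. ennreal (2 ^ k * (f k x)\<^sup>2)) \<noteq> \<infinity>"
    by (intro nn_integral_PInf_AE) auto
  then have lim: "AE x in \<nu>. convergent (\<lambda>n. S n x)"
  proof eventually_elim
    case (elim x)
    then have sq: "summable (\<lambda>k. 2 ^ k * (f k x)\<^sup>2)"
      by (intro summable_suminf_not_top) auto
    have "summable (\<lambda>k. f k x)"
    proof (rule summable_comparison_test')
      show "summable (\<lambda>k. 2 ^ k * (f k x)\<^sup>2 + (1 / 2) ^ k)"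
        by (intro summable_add sq summable_geometric) simp
      fix k :: nat
      \<comment> \<open>Expanding this square gives 2 |f| <= 2^k f^2 + 2^-k.\<close>
      have "0 \<le> (1 / 2) ^ k * (2 ^ k * \<bar>f k x\<bar> - 1)\<^sup>2" by simp
      also have "\<dots> = 2 ^ k * (f k x)\<^sup>2 - 2 * \<bar>f k x\<bar> + (1 / 2) ^ k"
        by (simp add: power2_diff power_mult_distrib power_divide field_simps power2_eq_square)
      finally show "norm (f k x) \<le> 2 ^ k * (f k x)\<^sup>2 + (1 / 2) ^ k"
        by simp
    qed
    then have "convergent (\<lambda>n. (\<Sum>k<n. f k x))" by (simp add: summable_iff_convergent)
    then have "convergent (\<lambda>n. S n x - S 0 x)"
      unfolding f_def by (simp add: sum_lessThan_telescope[of "\<lambda>k. S k x"])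
    then show ?case by (simp add: convergent_diff_const_right_iff)
  qed
  define u where "u x = lim (\<lambda>n. S n x)" for x
  have u_meas [measurable]: "u \<in> borel_measurable \<nu>"
    unfolding u_def by measurable
  have conv: "AE x in \<nu>. (\<lambda>n. S n x) \<longlonglongrightarrow> u x"
    using lim by eventually_elim (simp add: convergent_LIMSEQ_iff u_def)
  \<comment> \<open>Fatou's lemma is applied to S (n + k) - S n with n fixed and k tending to
    infinity.\<close>
  have *: "(\<lambda>x. u x - S n x) \<in> L2 \<nu>" "l2_norm \<nu> (\<lambda>x. u x - S n x) \<le> 2 * \<rho> n" for n
  proof -
    have "AE x in \<nu>. (\<lambda>k. S (n + k) x - S n x) \<longlonglongrightarrow> u x - S n x"
      using conv
    proof eventually_elim
      case (elim x)
      then show ?case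
        using LIMSEQ_ignore_initial_segment[OF elim, of n]
        by (intro tendsto_diff) (simp_all add: add.commute)
    qed
    moreover have "(\<lambda>x. S (n + k) x - S n x) \<in> L2 \<nu>" for k by (intro L2_diff S)
    moreover note l2_norm_diff_le_geometric[where S = S and \<nu> = \<nu> and \<rho> = \<rho>, OF S step \<rho>]
    ultimately show "(\<lambda>x. u x - S n x) \<in> L2 \<nu>" "l2_norm \<nu> (\<lambda>x. u x - S n x) \<le> 2 * \<rho> n"
      using l2_Fatou[of "\<lambda>k x. S (n + k) x - S n x" \<nu> "2 * \<rho> n" "\<lambda>x. u x - S n x"]
      by (auto intro: borel_measurable_diff)
  qed
  have "u \<in> L2 \<nu>"
    using L2_add[OF *(1)[of 0] S[of 0]] by simp
  then show ?thesis using * that by blast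
qed

section \<open>Symmetric contraction semigroups\<close>

locale l2_symmetric_semigroup =
  fixes \<nu> :: "'a measure" and T :: "real \<Rightarrow> ('a \<Rightarrow> real) \<Rightarrow> 'a \<Rightarrow> real"
  assumes operator: "\<And>t. 0 < t \<Longrightarrow> l2_operator \<nu> (L2 \<nu>) (T t)"
    and symmetric: "\<And>t u v. 0 < t \<Longrightarrow> u \<in> L2 \<nu> \<Longrightarrow> v \<in> L2 \<nu> \<Longrightarrow>
      l2_inner \<nu> (T t u) v = l2_inner \<nu> u (T t v)"
    and contraction: "\<And>t u. 0 < t \<Longrightarrow> u \<in> L2 \<nu> \<Longrightarrow> l2_norm \<nu> (T t u) \<le> l2_norm \<nu> u"
    and semigroup: "\<And>s t u. 0 < s \<Longrightarrow> 0 < t \<Longrightarrow> u \<in> L2 \<nu> \<Longrightarrow> ae_eq \<nu> (T (s + t) u) (T s (T t u))"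
    and strongly_continuous: "\<And>u. u \<in> L2 \<nu> \<Longrightarrow>
      ((\<lambda>t. l2_norm \<nu> (\<lambda>x. T t u x - u x)) \<longlongrightarrow> 0) (at_right 0)"
begin

text \<open>\<open>T\<close> is specified at positive times only. Setting the identity at time 0
  makes the semigroup law available on the closed half-line.\<close>

definition P :: "real \<Rightarrow> ('a \<Rightarrow> real) \<Rightarrow> 'a \<Rightarrow> real" where
  "P s u = (if s = 0 then u else T s u)"

lemma P_zero [simp]: "P 0 u = u"
  by (simp add: P_def)

lemma T_eq_P: "0 < s \<Longrightarrow> T s = P s"
  by (simp add: P_def fun_eq_iff)

lemma P_L2 [simp]: "0 \<le> s \<Longrightarrow> u \<in> L2 \<nu> \<Longrightarrow> P s u \<in> L2 \<nu>"
  using operator[of s] by (auto simp: P_def l2_operator_def)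

lemma P_symmetric:
  "0 \<le> s \<Longrightarrow> u \<in> L2 \<nu> \<Longrightarrow> v \<in> L2 \<nu> \<Longrightarrow> l2_inner \<nu> (P s u) v = l2_inner \<nu> u (P s v)"
  by (simp add: P_def symmetric)

lemma P_contraction: "0 \<le> s \<Longrightarrow> u \<in> L2 \<nu> \<Longrightarrow> l2_norm \<nu> (P s u) \<le> l2_norm \<nu> u"
  by (simp add: P_def contraction)

lemma P_semigroup: "0 \<le> a \<Longrightarrow> 0 \<le> b \<Longrightarrow> u \<in> L2 \<nu> \<Longrightarrow> ae_eq \<nu> (P (a + b) u) (P a (P b u))"
  using semigroup[of a b u] by (auto simp: P_def)

lemma P_add: "0 \<le> s \<Longrightarrow> u \<in> L2 \<nu> \<Longrightarrow> v \<in> L2 \<nu> \<Longrightarrow>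
    ae_eq \<nu> (P s (\<lambda>x. u x + v x)) (\<lambda>x. P s u x + P s v x)"
  using operator[of s] by (auto simp: P_def l2_operator_def)

lemma P_scale: "0 \<le> s \<Longrightarrow> u \<in> L2 \<nu> \<Longrightarrow> ae_eq \<nu> (P s (\<lambda>x. c * u x)) (\<lambda>x. c * P s u x)"
  using operator[of s] by (auto simp: P_def l2_operator_def)

lemma P_diff:
  assumes "0 \<le> s" "u \<in> L2 \<nu>" "v \<in> L2 \<nu>"
  shows "ae_eq \<nu> (P s (\<lambda>x. u x - v x)) (\<lambda>x. P s u x - P s v x)"
proof -
  have "ae_eq \<nu> (P s (\<lambda>x. u x + (-1) * v x)) (\<lambda>x. P s u x + P s (\<lambda>x. (-1) * v x) x)"
    using assms by (intro P_add L2_scale)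
  moreover have "ae_eq \<nu> (P s (\<lambda>x. (-1) * v x)) (\<lambda>x. (-1) * P s v x)"
    using assms by (intro P_scale)
  ultimately show ?thesis
    unfolding ae_eq_def by eventually_elim simp
qed

lemma P_inner_semigroup:
  assumes "0 \<le> a" "0 \<le> b" "u \<in> L2 \<nu>" "v \<in> L2 \<nu>"
  shows "l2_inner \<nu> (P (a + b) u) v = l2_inner \<nu> (P a u) (P b v)"
proof -
  have "l2_inner \<nu> (P (a + b) u) v = l2_inner \<nu> (P b (P a u)) v"
    using assms P_semigroup[of b a u] by (intro l2_inner_cong) (auto simp: add.commute)
  also have "\<dots> = l2_inner \<nu> (P a u) (P b v)"
    using assms by (intro P_symmetric) auto
  finally show ?thesis .
qed

lemma P_right_continuous:
  assumes "u \<in> L2 \<nu>" "0 < \<epsilon>"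
  obtains d where "0 < d" "\<And>h. 0 \<le> h \<Longrightarrow> h < d \<Longrightarrow> l2_norm \<nu> (\<lambda>x. P h u x - u x) < \<epsilon>"
proof -
  have "eventually (\<lambda>t. l2_norm \<nu> (\<lambda>x. T t u x - u x) < \<epsilon>) (at_right 0)"
    using strongly_continuous[OF assms(1)] assms(2) by (rule order_tendstoD)
  then obtain d where d: "0 < d" "\<And>h. 0 < h \<Longrightarrow> h < d \<Longrightarrow> l2_norm \<nu> (\<lambda>x. T h u x - u x) < \<epsilon>"
    by (auto simp: eventually_at_right_field)
  show ?thesis
  proof (rule that[OF d(1)])
    fix h :: real assume "0 \<le> h" "h < d"
    then show "l2_norm \<nu> (\<lambda>x. P h u x - u x) < \<epsilon>"
      using d(2)[of h] \<open>0 < \<epsilon>\<close> by (cases "h = 0") (auto simp: P_def)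
  qed
qed

text \<open>In spectral terms this is the Laplace transform of the spectral measure of u, hence
  nonnegative, decreasing and convex. The lemmas below derive these properties from symmetry and the
  semigroup law, without a spectral measure.\<close>

definition corr :: "('a \<Rightarrow> real) \<Rightarrow> real \<Rightarrow> real" where
  "corr u s = l2_inner \<nu> (P s u) u"

lemma corr_zero: "corr u 0 = (l2_norm \<nu> u)\<^sup>2"
  by (simp add: corr_def l2_norm_power2)

lemma corr_add: "0 \<le> a \<Longrightarrow> 0 \<le> b \<Longrightarrow> u \<in> L2 \<nu> \<Longrightarrow> corr u (a + b) = l2_inner \<nu> (P a u) (P b u)"
  by (simp add: corr_def P_inner_semigroup)

text \<open>Symmetry moves half of the time to the other factor. Positivity and monotonicity in s
  then become properties of a norm under contractions.\<close>

lemma corr_eq_norm: "0 \<le> s \<Longrightarrow> u \<in> L2 \<nu> \<Longrightarrow> corr u s = (l2_norm \<nu> (P (s / 2) u))\<^sup>2"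
  using corr_add[of "s / 2" "s / 2" u] by (simp add: l2_norm_power2)

lemma corr_nonneg: "0 \<le> s \<Longrightarrow> u \<in> L2 \<nu> \<Longrightarrow> 0 \<le> corr u s"
  by (simp add: corr_eq_norm)

lemma corr_antimono:
  assumes "0 \<le> a" "a \<le> b" "u \<in> L2 \<nu>"
  shows "corr u b \<le> corr u a"
proof -
  have "l2_norm \<nu> (P (b / 2) u) = l2_norm \<nu> (P ((b - a) / 2) (P (a / 2) u))"
    using assms P_semigroup[of "(b - a) / 2" "a / 2" u]
    by (intro l2_norm_cong) (auto simp: add_divide_distrib[symmetric])
  also have "\<dots> \<le> l2_norm \<nu> (P (a / 2) u)"
    using assms by (intro P_contraction) auto
  finally show ?thesis
    using assms by (simp add: corr_eq_norm power_mono)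
qed

text \<open>The midpoint is the sum of the half times a / 2 and b / 2, so Cauchy-Schwarz followed by
  2xy <= x^2 + y^2 applies.\<close>

lemma corr_midpoint:
  assumes "0 \<le> a" "0 \<le> b" "u \<in> L2 \<nu>"
  shows "2 * corr u ((a + b) / 2) \<le> corr u a + corr u b"
proof -
  have "2 * corr u ((a + b) / 2) = 2 * l2_inner \<nu> (P (a / 2) u) (P (b / 2) u)"
    using assms corr_add[of "a / 2" "b / 2" u] by (simp add: add_divide_distrib)
  also have "\<dots> \<le> 2 * (l2_norm \<nu> (P (a / 2) u) * l2_norm \<nu> (P (b / 2) u))"
    using l2_Cauchy_Schwarz[of "P (a / 2) u" \<nu> "P (b / 2) u"] assms by simp
  also have "\<dots> \<le> (l2_norm \<nu> (P (a / 2) u))\<^sup>2 + (l2_norm \<nu> (P (b / 2) u))\<^sup>2"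
    using zero_le_power2[of "l2_norm \<nu> (P (a / 2) u) - l2_norm \<nu> (P (b / 2) u)"]
    unfolding power2_diff by simp
  also have "\<dots> = corr u a + corr u b"
    using assms by (simp add: corr_eq_norm)
  finally show ?thesis .
qed

text \<open>Midpoint convexity at three neighbouring lattice points says that each decrement is at
  most the preceding one.\<close>

lemma corr_decrement_antimono:
  assumes "0 \<le> h" "m \<le> n" "u \<in> L2 \<nu>"
  shows "corr u (real n * h) - corr u (real (Suc n) * h) \<le>
    corr u (real m * h) - corr u (real (Suc m) * h)"
proof -
  have "corr u (real (Suc k) * h) - corr u (real (Suc (Suc k)) * h) \<le>
      corr u (real k * h) - corr u (real (Suc k) * h)" for k
    using corr_midpoint[of "real k * h" "real (Suc (Suc k)) * h" u] assms
    by (simp add: algebra_simps add_divide_distrib)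
  then show ?thesis
    using lift_Suc_antimono_le[of "\<lambda>k. corr u (real k * h) - corr u (real (Suc k) * h)" m n] assms(2)
    by blast
qed

lemma corr_lattice:
  assumes "0 \<le> h" "u \<in> L2 \<nu>"
  shows "corr u (real m * h) - corr u (real (m + n) * h) \<le> corr u 0 - corr u (real n * h)"
proof (induction n)
  case (Suc n)
  then show ?case
    using corr_decrement_antimono[of h n "m + n" u] assms by simp
qed simp

text \<open>The modulus of continuity does not depend on s because \<open>P s\<close> is a
  contraction. It bridges the gap between lattice times and arbitrary times.\<close>

lemma corr_right_uniform:
  assumes "0 \<le> s" "0 \<le> h" "u \<in> L2 \<nu>"
  shows "corr u s - corr u (s + h) \<le> l2_norm \<nu> u * l2_norm \<nu> (\<lambda>x. P h u x - u x)"
proof -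
  have "corr u s - corr u (s + h) = l2_inner \<nu> (P s u) (\<lambda>x. u x - P h u x)"
    using assms corr_add[of s h u] by (simp add: corr_def l2_inner_diff_right)
  also have "\<dots> \<le> l2_norm \<nu> (P s u) * l2_norm \<nu> (\<lambda>x. u x - P h u x)"
    using l2_Cauchy_Schwarz[of "P s u" \<nu> "\<lambda>x. u x - P h u x"] assms by (simp add: L2_diff)
  also have "\<dots> \<le> l2_norm \<nu> u * l2_norm \<nu> (\<lambda>x. u x - P h u x)"
    using assms by (intro mult_right_mono P_contraction) auto
  finally show ?thesis by (simp add: l2_norm_minus_commute)
qed

text \<open>The lattice inequality is used with a mesh that divides a exactly; b is rounded down to
  the lattice at a cost controlled by \<open>corr_right_uniform\<close>.\<close>

lemma corr_convex:
  assumes "0 \<le> a" "0 \<le> b" "u \<in> L2 \<nu>"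
  shows "corr u a - corr u (a + b) \<le> corr u 0 - corr u b"
proof (cases "a = 0")
  case False
  then have "0 < a" using assms by simp
  show ?thesis
  proof (rule field_le_epsilon)
    fix \<epsilon> :: real assume "0 < \<epsilon>"
    \<comment> \<open>The summand 1 keeps the denominator positive when u has norm zero.\<close>
    define \<epsilon>' where "\<epsilon>' = \<epsilon> / (l2_norm \<nu> u + 1)"
    have pos: "0 < l2_norm \<nu> u + 1" using l2_norm_nonneg[of \<nu> u] by linarith
    then have "0 < \<epsilon>'" using \<open>0 < \<epsilon>\<close> by (simp add: \<epsilon>'_def)
    then obtain d where d: "0 < d" "\<And>h. 0 \<le> h \<Longrightarrow> h < d \<Longrightarrow> l2_norm \<nu> (\<lambda>x. P h u x - u x) < \<epsilon>'"
      using P_right_continuous[OF assms(3)] by metis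
    \<comment> \<open>With this n the mesh a / n is below d, and so is the remainder of b after m
      full meshes.\<close>
    obtain n :: nat where n: "a / d < real n"
      using reals_Archimedean2 by blast
    moreover have "0 < a / d" using \<open>0 < a\<close> \<open>0 < d\<close> by simp
    ultimately have "0 < n" by (cases n) auto
    define h where "h = a / real n"
    define m where "m = nat \<lfloor>b / h\<rfloor>"
    have h: "0 < h" "h < d" "real n * h = a"
      using n \<open>0 < n\<close> \<open>0 < a\<close> \<open>0 < d\<close> by (auto simp: h_def field_simps)
    have "real m = of_int \<lfloor>b / h\<rfloor>" using assms h by (simp add: m_def)
    then have "real m \<le> b / h" "b / h < real m + 1" by linarith+
    then have m: "real m * h \<le> b" "b - real m * h < h"
      using h by (simp_all add: field_simps)
    have "corr u a - corr u (a + real m * h) \<le> corr u 0 - corr u (real m * h)"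
      using corr_lattice[of h u n m] h assms by (simp add: distrib_right)
    moreover have "corr u b \<le> corr u (real m * h)"
      using m h assms by (intro corr_antimono) auto
    moreover have "corr u (a + real m * h) - corr u (a + b) \<le> \<epsilon>"
    proof -
      have "corr u (a + real m * h) - corr u (a + b) \<le>
          l2_norm \<nu> u * l2_norm \<nu> (\<lambda>x. P (b - real m * h) u x - u x)"
        using corr_right_uniform[of "a + real m * h" "b - real m * h" u] m h assms by simp
      also have "\<dots> \<le> l2_norm \<nu> u * \<epsilon>'"
        using d(2)[of "b - real m * h"] m h by (intro mult_left_mono) auto
      also have "\<dots> \<le> (l2_norm \<nu> u + 1) * \<epsilon>'"
        using \<open>0 < \<epsilon>'\<close> by (intro mult_right_mono) auto
      also have "\<dots> = \<epsilon>" using pos by (simp add: \<epsilon>'_def)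
      finally show ?thesis .
    qed
    ultimately show "corr u a - corr u (a + b) \<le> corr u 0 - corr u b + \<epsilon>" by linarith
  qed
qed simp

text \<open>
  \<open>dissip u s = (u - T\<^sub>s u, u)\<close>, extended by \<open>0\<close> to \<open>s \<le> 0\<close> so that it is monotone on the whole line.
\<close>

definition dissip :: "('a \<Rightarrow> real) \<Rightarrow> real \<Rightarrow> real" where
  "dissip u s = l2_inner \<nu> u u - l2_inner \<nu> (P (max s 0) u) u"

lemma dissip_eq_corr: "dissip u s = corr u 0 - corr u (max s 0)"
  by (simp add: dissip_def corr_def)

lemma dissip_nonpos [simp]: "s \<le> 0 \<Longrightarrow> dissip u s = 0"
  by (simp add: dissip_def)

lemma mono_dissip: "u \<in> L2 \<nu> \<Longrightarrow> mono (dissip u)"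
  unfolding dissip_eq_corr[abs_def] by (intro monoI diff_left_mono corr_antimono) auto

lemma dissip_nonneg: "u \<in> L2 \<nu> \<Longrightarrow> 0 \<le> dissip u s"
  using corr_antimono[of 0 "max s 0" u] by (simp add: dissip_eq_corr)

lemma dissip_le_norm: "u \<in> L2 \<nu> \<Longrightarrow> dissip u s \<le> (l2_norm \<nu> u)\<^sup>2"
  using corr_nonneg[of "max s 0" u] by (simp add: dissip_eq_corr corr_zero)

lemma dissip_borel [measurable]: "u \<in> L2 \<nu> \<Longrightarrow> dissip u \<in> borel_measurable borel"
  by (intro borel_measurable_mono mono_dissip)

text \<open>A concave function that vanishes at 0 is subadditive; this is \<open>corr_convex\<close>
  rearranged.\<close>

lemma dissip_subadditive:
  "u \<in> L2 \<nu> \<Longrightarrow> 0 \<le> a \<Longrightarrow> 0 \<le> b \<Longrightarrow> dissip u (a + b) \<le> dissip u a + dissip u b"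
  using corr_convex[of a b u] by (simp add: dissip_eq_corr)

text \<open>At fixed s, \<open>dissip\<close> is a quadratic form in its function argument. The
  expansion with a free factor r feeds the discriminant argument, and r = 1 then gives the triangle
  inequality.\<close>

lemma dissip_add_scale:
  assumes "u \<in> L2 \<nu>" "v \<in> L2 \<nu>"
  shows "dissip (\<lambda>x. u x + r * v x) s =
    dissip u s + 2 * r * (l2_inner \<nu> u v - l2_inner \<nu> (P (max s 0) u) v) + r\<^sup>2 * dissip v s"
proof -
  let ?s = "max s 0" and ?rv = "\<lambda>x. r * v x"
  have rv: "?rv \<in> L2 \<nu>" using assms by auto
  have "l2_inner \<nu> (P ?s (\<lambda>x. u x + r * v x)) w = l2_inner \<nu> (P ?s u) w + r * l2_inner \<nu> (P ?s v) w"
    if w: "w \<in> L2 \<nu>" for w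
  proof -
    have "l2_inner \<nu> (P ?s (\<lambda>x. u x + r * v x)) w = l2_inner \<nu> (\<lambda>x. P ?s u x + P ?s ?rv x) w"
      using assms rv w by (intro l2_inner_cong P_add P_L2 L2_add) auto
    also have "\<dots> = l2_inner \<nu> (P ?s u) w + l2_inner \<nu> (P ?s ?rv) w"
      using assms rv w by (intro l2_inner_add_left P_L2) auto
    also have "l2_inner \<nu> (P ?s ?rv) w = l2_inner \<nu> (\<lambda>x. r * P ?s v x) w"
      using assms rv w by (intro l2_inner_cong P_scale P_L2 L2_scale) auto
    finally show ?thesis by (simp add: l2_inner_scale_left)
  qed
  moreover have "l2_inner \<nu> (P ?s v) u = l2_inner \<nu> (P ?s u) v"
    using assms P_symmetric[of ?s v u] by (simp add: l2_inner_commute)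
  ultimately show ?thesis
    unfolding dissip_def using assms rv
    by (simp add: l2_inner_add_scale l2_inner_add_right l2_inner_scale_right L2_add
        algebra_simps power2_eq_square)
qed

lemma sqrt_dissip_triangle:
  assumes "u \<in> L2 \<nu>" "v \<in> L2 \<nu>"
  shows "sqrt (dissip (\<lambda>x. u x + v x) s) \<le> sqrt (dissip u s) + sqrt (dissip v s)"
proof -
  let ?b = "l2_inner \<nu> u v - l2_inner \<nu> (P (max s 0) u) v"
  have "0 \<le> dissip u s + 2 * r * ?b + r\<^sup>2 * dissip v s" for r
    unfolding dissip_add_scale[OF assms, symmetric] using assms by (intro dissip_nonneg) auto
  then have "?b\<^sup>2 \<le> dissip u s * dissip v s"
    using assms by (intro power2_le_mult_if_quadratic_nonneg dissip_nonneg) auto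
  from sqrt_quadratic_le[OF this] assms show ?thesis
    using dissip_add_scale[OF assms, of 1 s] by (simp add: dissip_nonneg)
qed

lemma dissip_scale:
  assumes "u \<in> L2 \<nu>"
  shows "dissip (\<lambda>x. c * u x) s = c\<^sup>2 * dissip u s"
proof -
  \<comment> \<open>Writing c u as u + (c - 1) u makes the expansion applicable with v = u.\<close>
  have "dissip (\<lambda>x. u x + (c - 1) * u x) s = dissip u s + 2 * (c - 1) * dissip u s + (c - 1)\<^sup>2 * dissip u s"
    using dissip_add_scale[OF assms assms] by (simp add: dissip_def)
  then show ?thesis by (simp add: algebra_simps power2_eq_square)
qed

lemma sqrt_dissip_le_norm: "u \<in> L2 \<nu> \<Longrightarrow> sqrt (dissip u s) \<le> l2_norm \<nu> u"
  by (rule real_le_lsqrt) (simp_all add: dissip_nonneg dissip_le_norm)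

text \<open>The Lipschitz constant 1 is uniform in s, so estimates of dissipation pass to L2
  limits.\<close>

lemma sqrt_dissip_diff:
  assumes "u \<in> L2 \<nu>" "v \<in> L2 \<nu>"
  shows "sqrt (dissip u s) \<le> sqrt (dissip v s) + l2_norm \<nu> (\<lambda>x. u x - v x)"
  using sqrt_dissip_triangle[of v "\<lambda>x. u x - v x" s] sqrt_dissip_le_norm[of "\<lambda>x. u x - v x" s] assms
  by (simp add: L2_diff)

end

section \<open>Subordination\<close>

lemma subadditive_real_multiple:
  fixes f :: "real \<Rightarrow> real"
  assumes "\<And>s t. 0 < s \<Longrightarrow> 0 < t \<Longrightarrow> f (s + t) \<le> f s + f t" "0 < t"
  shows "f (real (Suc n) * t) \<le> real (Suc n) * f t"
proof (induction n)
  case (Suc n)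
  have "f (real (Suc (Suc n)) * t) = f (real (Suc n) * t + t)"
    by (simp add: algebra_simps)
  also have "\<dots> \<le> f (real (Suc n) * t) + f t"
    using assms by (intro assms(1)) auto
  finally show ?case using Suc by (simp add: algebra_simps)
qed simp

text \<open>A variant of Fekete's lemma at the origin.\<close>

lemma tendsto_subadditive_quotient:
  fixes f :: "real \<Rightarrow> real"
  assumes nonneg: "\<And>t. 0 < t \<Longrightarrow> 0 \<le> f t"
    and mono: "\<And>s t. 0 < s \<Longrightarrow> s \<le> t \<Longrightarrow> f s \<le> f t"
    and subadd: "\<And>s t. 0 < s \<Longrightarrow> 0 < t \<Longrightarrow> f (s + t) \<le> f s + f t"
    and bound: "\<And>t. 0 < t \<Longrightarrow> f t \<le> C * t"
  shows "((\<lambda>t. f t / t) \<longlongrightarrow> (SUP t\<in>{0<..}. f t / t)) (at_right 0)"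
proof (rule order_tendstoI)
  let ?l = "SUP t\<in>{0<..}. f t / t"
  have bdd: "bdd_above ((\<lambda>t. f t / t) ` {0<..})"
    using bound by (intro bdd_aboveI[of _ C]) (auto simp: field_simps)
  {
    fix a assume "a < ?l"
    then obtain r where r: "0 < r" "a < f r / r"
      using less_cSUP_iff[OF _ bdd] by auto
    \<comment> \<open>As t tends to 0 this quotient tends to f r / r, which exceeds a; it remains to
      bound f t / t below by it.\<close>
    have "((\<lambda>t. f r / (r + t)) \<longlongrightarrow> f r / (r + 0)) (at_right 0)"
      using r by (intro tendsto_intros) auto
    then have "eventually (\<lambda>t. a < f r / (r + t)) (at_right 0)"
      using r by (intro order_tendstoD) auto
    then show "eventually (\<lambda>t. a < f t / t) (at_right 0)"
      using eventually_at_right_less[of 0]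
    proof eventually_elim
      case (elim t)
      \<comment> \<open>n + 1 steps of length t cover r, while n + 1 is at most r / t + 1.\<close>
      define n where "n = nat \<lfloor>r / t\<rfloor>"
      have "real n = of_int \<lfloor>r / t\<rfloor>" using elim r by (simp add: n_def)
      then have n: "real n \<le> r / t" "r / t < real (Suc n)" by (simp, linarith)+
      have "f r \<le> f (real (Suc n) * t)"
        using n r elim by (intro mono) (auto simp: field_simps)
      also have "\<dots> \<le> real (Suc n) * f t"
        using elim by (intro subadditive_real_multiple subadd)
      also have "\<dots> \<le> (r / t + 1) * f t"
        using n nonneg elim by (intro mult_right_mono) auto
      also have "\<dots> = (r + t) * (f t / t)"
        using elim by (simp add: field_simps)
      finally have "f r / (r + t) \<le> f t / t"
        using r elim by (simp add: field_simps)
      with elim show ?case by linarith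
    qed
  next
    fix a assume "?l < a"
    show "eventually (\<lambda>t. f t / t < a) (at_right 0)"
      using eventually_at_right_less[of 0]
    proof eventually_elim
      case (elim t)
      have "f t / t \<le> ?l" using elim by (intro cSUP_upper bdd) auto
      with \<open>?l < a\<close> show ?case by linarith
    qed
  }
qed

text \<open>The mean of 1 - exp (- x) is accessible through the Laplace transform. The intermediate
  bound 2x / (1 + x) comes from exp x >= 1 + x.\<close>

lemma min_1_le_one_minus_exp:
  fixes x :: real
  assumes "0 \<le> x"
  shows "min 1 x \<le> 2 * (1 - exp (- x))"
proof -
  have "1 + x \<le> exp x" by (rule exp_ge_add_one_self)
  then have "exp (- x) \<le> 1 / (1 + x)" using assms by (simp add: exp_minus field_simps)
  then have "2 * (1 - 1 / (1 + x)) \<le> 2 * (1 - exp (- x))" by simp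
  moreover have "min 1 x \<le> 2 * (1 - 1 / (1 + x))"
  proof (cases "x \<le> 1")
    case True
    then have "x * x \<le> x * 1" using assms by (intro mult_left_mono) auto
    then show ?thesis using True assms by (simp add: field_simps)
  next
    case False
    then show ?thesis by (simp add: field_simps)
  qed
  ultimately show ?thesis by linarith
qed

section \<open>Mean dissipation at the random time of the subordinator\<close>

locale subordinated_l2_semigroup = l2_symmetric_semigroup \<nu> T
  for \<nu> :: "'a measure" and T :: "real \<Rightarrow> ('a \<Rightarrow> real) \<Rightarrow> 'a \<Rightarrow> real" +
  fixes \<delta> :: real and M :: "'b measure" and \<xi> :: "real \<Rightarrow> 'b \<Rightarrow> real"
    and \<eta> :: "real \<Rightarrow> real \<Rightarrow> real" and T' :: "real \<Rightarrow> ('a \<Rightarrow> real) \<Rightarrow> 'a \<Rightarrow> real"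
  assumes \<delta>: "0 < \<delta>" "\<delta> < 1"
    and subordinator: "stable_subordinator \<delta> M \<xi>"
    and density: "density_on_positive M \<xi> \<eta>"
    and subordinated: "subordinated_semigroup \<nu> T \<eta> T'"
begin

sublocale prob_space M
  using subordinator by (simp add: stable_subordinator_def levy_process_def)

lemma \<xi>_borel [measurable]: "0 \<le> t \<Longrightarrow> \<xi> t \<in> borel_measurable M"
  using subordinator by (simp add: stable_subordinator_def levy_process_def)

lemma distributed_\<xi>:
  "0 < t \<Longrightarrow> distributed M lborel (\<xi> t) (\<lambda>s. ennreal (indicator {0<..} s * \<eta> t s))"
  using density by (simp add: density_on_positive_def)

lemma AE_\<xi>_pos:
  assumes "0 < t"
  shows "AE \<omega> in M. 0 < \<xi> t \<omega>"
proof -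
  have "AE s in density lborel (\<lambda>s. ennreal (indicator {0<..} s * \<eta> t s)). 0 < s"
    using distributed_\<xi>[OF assms] by (subst AE_density) (auto simp: distributed_def indicator_def)
  then have "AE s in distr M lborel (\<xi> t). 0 < s"
    unfolding distributed_distr_eq_density[OF distributed_\<xi>[OF assms]] .
  then show ?thesis
    using assms by (subst (asm) AE_distr_iff) (auto simp: measurable_lborel1)
qed

lemma distr_increment:
  "0 \<le> s \<Longrightarrow> 0 \<le> t \<Longrightarrow> distr M borel (\<lambda>\<omega>. \<xi> (s + t) \<omega> - \<xi> s \<omega>) = distr M borel (\<xi> t)"
  using subordinator by (simp add: stable_subordinator_def levy_process_def)

text \<open>\<open>levy_process\<close> does not postulate increasing paths. Stationarity gives the
  increment the law of \<xi> at time t, which is carried by the positive half-line; the exceptional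
  null set depends on s and t.\<close>

lemma AE_increment_pos:
  assumes "0 \<le> s" "0 < t"
  shows "AE \<omega> in M. 0 < \<xi> (s + t) \<omega> - \<xi> s \<omega>"
proof -
  have "AE x in distr M borel (\<xi> t). 0 < x"
    using AE_\<xi>_pos[of t] assms by (subst AE_distr_iff) auto
  then have "AE x in distr M borel (\<lambda>\<omega>. \<xi> (s + t) \<omega> - \<xi> s \<omega>). 0 < x"
    unfolding distr_increment[OF assms(1) less_imp_le[OF assms(2)]] .
  then show ?thesis
    using assms by (subst (asm) AE_distr_iff) auto
qed

definition mean_dissip :: "('a \<Rightarrow> real) \<Rightarrow> real \<Rightarrow> real" where
  "mean_dissip u t = (\<integral>\<omega>. dissip u (\<xi> t \<omega>) \<partial>M)"

lemma dissip_compose_integrable: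
  assumes "u \<in> L2 \<nu>" "f \<in> borel_measurable M"
  shows "integrable M (\<lambda>\<omega>. dissip u (f \<omega>))"
proof (rule integrable_const_bound)
  show "AE \<omega> in M. norm (dissip u (f \<omega>)) \<le> (l2_norm \<nu> u)\<^sup>2"
    using assms by (auto simp: dissip_nonneg dissip_le_norm)
  show "(\<lambda>\<omega>. dissip u (f \<omega>)) \<in> borel_measurable M"
    using assms by measurable
qed

text \<open>The weak integral defining T' is tested with v = u, and the density turns it into an
  expectation over the subordinator. This links the quotients in the energy of T' to
  \<open>mean_dissip\<close>.\<close>

lemma inner_subordinated:
  assumes "0 < t" "u \<in> L2 \<nu>"
  shows "l2_inner \<nu> (\<lambda>x. u x - T' t u x) u = mean_dissip u t"
proof -
  let ?f = "\<lambda>s. l2_inner \<nu> u u - dissip u s"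
  have *: "T' t u \<in> L2 \<nu>"
    "l2_inner \<nu> (T' t u) u = (LINT s:{0<..}|lborel. l2_inner \<nu> (T s u) u * \<eta> t s)"
    using subordinated assms by (auto simp: subordinated_semigroup_def)
  note *(2)
  also have "(LINT s:{0<..}|lborel. l2_inner \<nu> (T s u) u * \<eta> t s) =
      (\<integral>s. indicator {0<..} s * \<eta> t s * ?f s \<partial>lborel)"
    unfolding set_lebesgue_integral_def
    by (intro Bochner_Integration.integral_cong) (auto simp: indicator_def dissip_def P_def)
  also have "\<dots> = (\<integral>\<omega>. ?f (\<xi> t \<omega>) \<partial>M)"
    using distributed_\<xi>[OF assms(1)] density assms
    by (intro distributed_integral) (auto simp: density_on_positive_def indicator_def)
  also have "\<dots> = l2_inner \<nu> u u - mean_dissip u t"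
    using assms by (simp add: mean_dissip_def dissip_compose_integrable prob_space)
  finally show ?thesis
    using assms * by (simp add: l2_inner_diff_left)
qed

lemma mean_dissip_nonneg: "u \<in> L2 \<nu> \<Longrightarrow> 0 \<le> mean_dissip u t"
  unfolding mean_dissip_def by (intro integral_nonneg_AE) (simp add: dissip_nonneg)

lemma mean_dissip_mono:
  assumes "0 < s" "s \<le> t" "u \<in> L2 \<nu>"
  shows "mean_dissip u s \<le> mean_dissip u t"
proof (cases "s = t")
  case False
  have "AE \<omega> in M. 0 < \<xi> (s + (t - s)) \<omega> - \<xi> s \<omega>"
    using assms False by (intro AE_increment_pos) auto
  then have "AE \<omega> in M. dissip u (\<xi> s \<omega>) \<le> dissip u (\<xi> t \<omega>)"
    by eventually_elim (auto intro: monoD[OF mono_dissip[OF assms(3)]])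
  then show ?thesis
    unfolding mean_dissip_def
    using assms by (intro integral_mono_AE dissip_compose_integrable) auto
qed simp

text \<open>
  Subadditivity of \<open>dissip\<close> holds along each path, so the increment enters only through its law.
\<close>

lemma mean_dissip_subadditive:
  assumes "0 < s" "0 < t" "u \<in> L2 \<nu>"
  shows "mean_dissip u (s + t) \<le> mean_dissip u s + mean_dissip u t"
proof -
  let ?d = "\<lambda>\<omega>. \<xi> (s + t) \<omega> - \<xi> s \<omega>"
  have d: "?d \<in> borel_measurable M" using assms by auto
  have "AE \<omega> in M. dissip u (\<xi> (s + t) \<omega>) \<le> dissip u (\<xi> s \<omega>) + dissip u (?d \<omega>)"
    using AE_\<xi>_pos[OF assms(1)] AE_increment_pos[OF less_imp_le[OF assms(1)] assms(2)]
  proof eventually_elim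
    case (elim \<omega>)
    then show ?case using dissip_subadditive[of u "\<xi> s \<omega>" "?d \<omega>"] assms by simp
  qed
  then have "mean_dissip u (s + t) \<le> (\<integral>\<omega>. dissip u (\<xi> s \<omega>) + dissip u (?d \<omega>) \<partial>M)"
    unfolding mean_dissip_def using assms d
    by (intro integral_mono_AE dissip_compose_integrable Bochner_Integration.integrable_add) auto
  also have "\<dots> = mean_dissip u s + (\<integral>\<omega>. dissip u (?d \<omega>) \<partial>M)"
    using assms d by (simp add: mean_dissip_def dissip_compose_integrable)
  also have "(\<integral>\<omega>. dissip u (?d \<omega>) \<partial>M) = (\<integral>x. dissip u x \<partial>distr M borel ?d)"
    using assms d by (subst integral_distr) auto
  also have "\<dots> = mean_dissip u t"
    unfolding mean_dissip_def using assms by (simp add: distr_increment integral_distr)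
  finally show ?thesis .
qed

text \<open>The energy is written with \<open>Lim\<close>, so a bound on the quotients says nothing
  until the limit is known to exist. Subadditivity of \<open>mean_dissip\<close> in t provides the
  existence.\<close>

lemma semigroup_form_domainI:
  assumes "u \<in> L2 \<nu>" "\<And>t. 0 < t \<Longrightarrow> mean_dissip u t \<le> C * t"
  shows "u \<in> semigroup_form_domain \<nu> T'"
proof -
  define l where "l = (SUP t\<in>{0<..}. mean_dissip u t / t)"
  have "((\<lambda>t. mean_dissip u t / t) \<longlongrightarrow> l) (at_right 0)"
    unfolding l_def using assms
    by (intro tendsto_subadditive_quotient[where C = C] mean_dissip_nonneg mean_dissip_mono
        mean_dissip_subadditive)
  then have "((\<lambda>t. ereal (mean_dissip u t / t)) \<longlongrightarrow> ereal l) (at_right 0)"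
    by (rule tendsto_ereal)
  moreover have "eventually (\<lambda>t. ereal (mean_dissip u t / t) =
      ereal (1 / t * l2_inner \<nu> (\<lambda>x. u x - T' t u x) u)) (at_right 0)"
    using eventually_at_right_less[of 0]
    by eventually_elim (simp add: inner_subordinated assms(1))
  ultimately have "((\<lambda>t. ereal (1 / t * l2_inner \<nu> (\<lambda>x. u x - T' t u x) u)) \<longlongrightarrow> ereal l) (at_right 0)"
    by (rule Lim_transform_eventually)
  then have "semigroup_energy \<nu> T' u = ereal l"
    unfolding semigroup_energy_def by (intro tendsto_Lim) (auto simp: trivial_limit_at_right_real)
  then show ?thesis using assms by (simp add: semigroup_form_domain_def)
qed

text \<open>min 1 (c s) is dominated by 2 (1 - exp (- c s)), and the Laplace transform at c gives
  the mean of the latter at the random time: twice 1 - exp (- t c^\<delta>), hence at most 2 t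
  c^\<delta>.\<close>

lemma mean_dissip_le:
  assumes "u \<in> L2 \<nu>" "0 < t" "0 < c" "0 \<le> K"
    and "\<And>s. 0 < s \<Longrightarrow> dissip u s \<le> K * min 1 (c * s)"
  shows "mean_dissip u t \<le> 2 * K * c powr \<delta> * t"
proof -
  have Laplace: "(\<integral>\<omega>. exp (- c * \<xi> t \<omega>) \<partial>M) = exp (- t * c powr \<delta>)"
    using subordinator assms by (simp add: stable_subordinator_def)
  \<comment> \<open>A non-integrable function has integral 0 by convention, whereas the value here
    is an exponential.\<close>
  then have int: "integrable M (\<lambda>\<omega>. exp (- c * \<xi> t \<omega>))"
    by (metis exp_not_eq_zero not_integrable_integral_eq)
  have "AE \<omega> in M. dissip u (\<xi> t \<omega>) \<le> 2 * K * (1 - exp (- c * \<xi> t \<omega>))"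
    using AE_\<xi>_pos[OF assms(2)]
  proof eventually_elim
    case (elim \<omega>)
    have "dissip u (\<xi> t \<omega>) \<le> K * min 1 (c * \<xi> t \<omega>)" using assms elim by auto
    also have "\<dots> \<le> K * (2 * (1 - exp (- (c * \<xi> t \<omega>))))"
      using assms elim by (intro mult_left_mono min_1_le_one_minus_exp) auto
    finally show ?case by (simp add: algebra_simps)
  qed
  then have "mean_dissip u t \<le> (\<integral>\<omega>. 2 * K * (1 - exp (- c * \<xi> t \<omega>)) \<partial>M)"
    unfolding mean_dissip_def using assms int
    by (intro integral_mono_AE dissip_compose_integrable integrable_mult_right
        Bochner_Integration.integrable_diff) auto
  also have "\<dots> = 2 * K * (1 - exp (- t * c powr \<delta>))"
    using int Laplace by (simp add: prob_space)
  also have "\<dots> \<le> 2 * K * (t * c powr \<delta>)"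
    using assms exp_ge_add_one_self[of "- t * c powr \<delta>"] by (intro mult_left_mono) auto
  finally show ?thesis by (simp add: mult_ac)
qed

text \<open>Read as a norm in L2(M), the square root of \<open>mean_dissip\<close> inherits
  Minkowski's inequality from the general L2 lemmas.\<close>

lemma mean_dissip_eq_l2_norm:
  assumes "u \<in> L2 \<nu>" "0 \<le> t"
  shows "(\<lambda>\<omega>. sqrt (dissip u (\<xi> t \<omega>))) \<in> L2 M"
    and "l2_norm M (\<lambda>\<omega>. sqrt (dissip u (\<xi> t \<omega>))) = sqrt (mean_dissip u t)"
proof -
  have int: "integrable M (\<lambda>\<omega>. dissip u (\<xi> t \<omega>))"
    using assms by (intro dissip_compose_integrable) auto
  then have "(\<lambda>\<omega>. sqrt (dissip u (\<xi> t \<omega>))) \<in> borel_measurable M"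
    by (intro measurable_compose[OF _ borel_measurable_sqrt] borel_measurable_integrable)
  then show "(\<lambda>\<omega>. sqrt (dissip u (\<xi> t \<omega>))) \<in> L2 M"
    using int by (simp add: L2_def dissip_nonneg[OF assms(1)])
  show "l2_norm M (\<lambda>\<omega>. sqrt (dissip u (\<xi> t \<omega>))) = sqrt (mean_dissip u t)"
    unfolding l2_norm_def l2_inner_def mean_dissip_def
    by (simp add: dissip_nonneg[OF assms(1)])
qed

text \<open>Two triangle inequalities are combined: for \<open>dissip\<close> at each outcome, then
  in L2(M).\<close>

lemma sqrt_mean_dissip_triangle:
  assumes "u \<in> L2 \<nu>" "v \<in> L2 \<nu>" "0 \<le> t"
  shows "sqrt (mean_dissip (\<lambda>x. u x + v x) t) \<le> sqrt (mean_dissip u t) + sqrt (mean_dissip v t)"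
proof -
  let ?f = "\<lambda>u \<omega>. sqrt (dissip u (\<xi> t \<omega>))"
  have uv: "(\<lambda>x. u x + v x) \<in> L2 \<nu>" using assms by auto
  have "l2_norm M (?f (\<lambda>x. u x + v x)) \<le> l2_norm M (\<lambda>\<omega>. ?f u \<omega> + ?f v \<omega>)"
    using assms uv
    by (intro l2_norm_mono(2) L2_add L2_borel mean_dissip_eq_l2_norm(1))
      (simp_all add: dissip_nonneg sqrt_dissip_triangle)
  also have "\<dots> \<le> l2_norm M (?f u) + l2_norm M (?f v)"
    using assms by (intro l2_norm_triangle mean_dissip_eq_l2_norm(1))
  finally show ?thesis using assms uv by (simp add: mean_dissip_eq_l2_norm(2))
qed

lemma sqrt_mean_dissip_le_norm:
  assumes "u \<in> L2 \<nu>" "0 \<le> t"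
  shows "sqrt (mean_dissip u t) \<le> l2_norm \<nu> u"
proof (rule real_le_lsqrt)
  have "mean_dissip u t \<le> (\<integral>\<omega>. (l2_norm \<nu> u)\<^sup>2 \<partial>M)"
    unfolding mean_dissip_def using assms
    by (intro integral_mono_AE dissip_compose_integrable) (auto simp: dissip_le_norm)
  then show "mean_dissip u t \<le> (l2_norm \<nu> u)\<^sup>2" by (simp add: prob_space)
qed simp

end

section \<open>The generator and its square root\<close>

lemma
  assumes "l2_subspace \<nu> V"
  shows l2_subspace_zero: "(\<lambda>_. 0) \<in> V"
    and l2_subspace_add: "u \<in> V \<Longrightarrow> v \<in> V \<Longrightarrow> (\<lambda>x. u x + v x) \<in> V"
    and l2_subspace_scale: "u \<in> V \<Longrightarrow> (\<lambda>x. c * u x) \<in> V"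
    and l2_subspace_ae_eq: "u \<in> V \<Longrightarrow> v \<in> L2 \<nu> \<Longrightarrow> ae_eq \<nu> u v \<Longrightarrow> v \<in> V"
  using assms unfolding l2_subspace_def by blast+

lemma l2_subspace_diff:
  assumes "l2_subspace \<nu> V" "u \<in> V" "v \<in> V"
  shows "(\<lambda>x. u x - v x) \<in> V"
  using l2_subspace_add[OF assms(1,2) l2_subspace_scale[OF assms(1,3), of "-1"]] by simp

locale l2_generated_semigroup = l2_symmetric_semigroup \<nu> T
  for \<nu> :: "'a measure" and T :: "real \<Rightarrow> ('a \<Rightarrow> real) \<Rightarrow> 'a \<Rightarrow> real" +
  fixes D :: "('a \<Rightarrow> real) set" and A :: "('a \<Rightarrow> real) \<Rightarrow> 'a \<Rightarrow> real"
    and F :: "('a \<Rightarrow> real) set" and B :: "('a \<Rightarrow> real) \<Rightarrow> 'a \<Rightarrow> real"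
  assumes generator: "infinitesimal_generator \<nu> T D A"
    and dense: "l2_dense \<nu> D"
    and root: "is_sqrt_of_minus \<nu> D A F B"
begin

lemma D_subspace: "l2_subspace \<nu> D"
  using generator unfolding infinitesimal_generator_def l2_operator_def by blast

lemma D_L2 [simp]: "v \<in> D \<Longrightarrow> v \<in> L2 \<nu>"
  using D_subspace unfolding l2_subspace_def by blast

lemmas D_zero = l2_subspace_zero[OF D_subspace]
  and D_add = l2_subspace_add[OF D_subspace]
  and D_scale = l2_subspace_scale[OF D_subspace]

lemma A_L2 [simp]: "v \<in> D \<Longrightarrow> A v \<in> L2 \<nu>"
  using generator unfolding infinitesimal_generator_def l2_operator_def by blast

lemma F_subspace: "l2_subspace \<nu> F"
  using root unfolding is_sqrt_of_minus_def l2_selfadjoint_def l2_operator_def by blast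

lemma F_L2 [simp]: "u \<in> F \<Longrightarrow> u \<in> L2 \<nu>"
  using root unfolding is_sqrt_of_minus_def l2_selfadjoint_def l2_operator_def l2_subspace_def by blast

lemma B_L2 [simp]: "u \<in> F \<Longrightarrow> B u \<in> L2 \<nu>"
  using root unfolding is_sqrt_of_minus_def l2_selfadjoint_def l2_operator_def by blast

lemma D_F [simp]: "v \<in> D \<Longrightarrow> v \<in> F"
  and BD_F [simp]: "v \<in> D \<Longrightarrow> B v \<in> F"
  using root unfolding is_sqrt_of_minus_def by blast+

lemma BB_eq: "v \<in> D \<Longrightarrow> ae_eq \<nu> (B (B v)) (\<lambda>x. - A v x)"
  using root unfolding is_sqrt_of_minus_def by blast

text \<open>Self-adjointness of B moves one factor of B (B v) = - A v onto u, so that u is required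
  only in the form domain.\<close>

lemma inner_A:
  assumes "u \<in> F" "v \<in> D"
  shows "l2_inner \<nu> u (A v) = - l2_inner \<nu> (B u) (B v)"
proof -
  have "\<forall>w\<in>F. l2_inner \<nu> u (B w) = l2_inner \<nu> (B u) w"
    using root assms(1) F_L2[OF assms(1)] B_L2[OF assms(1)] ae_eq_refl
    unfolding is_sqrt_of_minus_def l2_selfadjoint_def by blast
  then have "l2_inner \<nu> (B u) (B v) = l2_inner \<nu> u (B (B v))"
    using assms by simp
  also have "\<dots> = l2_inner \<nu> u (\<lambda>x. - A v x)"
    using BB_eq assms by (intro l2_inner_cong) auto
  finally show ?thesis by (simp add: l2_inner_minus_right)
qed

lemma norm_B_power2: "v \<in> D \<Longrightarrow> (l2_norm \<nu> (B v))\<^sup>2 = - l2_inner \<nu> (A v) v"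
  using inner_A[of v v] by (simp add: l2_norm_power2 l2_inner_commute)

section \<open>Difference quotients along orbits and the bound of dissipation by the form\<close>

lemma generator_limit:
  "v \<in> D \<Longrightarrow> ((\<lambda>h. l2_norm \<nu> (\<lambda>x. (T h v x - v x) / h - A v x)) \<longlongrightarrow> 0) (at_right 0)"
  using generator A_L2 D_L2 ae_eq_refl unfolding infinitesimal_generator_def by blast

text \<open>The difference quotient of \<open>P t v\<close> is \<open>P t\<close> applied to that of
  v, so contraction makes it converge to \<open>P t (A v)\<close>. The graph of A consists of
  exactly such limits, which yields both claims.\<close>

lemma
  assumes "0 \<le> t" "v \<in> D"
  shows P_D: "P t v \<in> D"
    and A_P: "ae_eq \<nu> (P t (A v)) (A (P t v))"
proof -
  have "((\<lambda>h. l2_norm \<nu> (\<lambda>x. (T h (P t v) x - P t v x) / h - P t (A v) x)) \<longlongrightarrow> 0) (at_right 0)"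
  proof (rule Lim_null_comparison[OF _ generator_limit[OF assms(2)]])
    show "eventually (\<lambda>h. norm (l2_norm \<nu> (\<lambda>x. (T h (P t v) x - P t v x) / h - P t (A v) x)) \<le>
        l2_norm \<nu> (\<lambda>x. (T h v x - v x) / h - A v x)) (at_right 0)"
      using eventually_at_right_less[of 0]
    proof eventually_elim
      case (elim h)
      let ?q = "\<lambda>x. (P h v x - v x) / h"
      \<comment> \<open>This is \<open>?q\<close> with the division written as a scalar multiple,
        the form to which \<open>P_scale\<close> applies.\<close>
      let ?q' = "\<lambda>x. (1 / h) * (P h v x - v x)"
      have Th: "T h = P h" using elim by (rule T_eq_P)
      have Phv: "P h v \<in> L2 \<nu>" "P h (P t v) \<in> L2 \<nu>" using elim assms by auto
      have "ae_eq \<nu> (P t (\<lambda>x. ?q' x - A v x)) (\<lambda>x. P t ?q' x - P t (A v) x)"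
        using assms Phv by (intro P_diff L2_scale L2_diff) auto
      moreover have "ae_eq \<nu> (P t ?q') (\<lambda>x. (1 / h) * P t (\<lambda>x. P h v x - v x) x)"
        using assms Phv by (intro P_scale L2_diff) auto
      moreover have "ae_eq \<nu> (P t (\<lambda>x. P h v x - v x)) (\<lambda>x. P t (P h v) x - P t v x)"
        using assms Phv by (intro P_diff) auto
      moreover have "ae_eq \<nu> (P (t + h) v) (P t (P h v))" "ae_eq \<nu> (P (h + t) v) (P h (P t v))"
        using assms elim by (auto intro!: P_semigroup)
      ultimately have "ae_eq \<nu> (\<lambda>x. (P h (P t v) x - P t v x) / h - P t (A v) x) (P t (\<lambda>x. ?q x - A v x))"
        unfolding ae_eq_def by eventually_elim (simp add: add.commute)
      then have "l2_norm \<nu> (\<lambda>x. (P h (P t v) x - P t v x) / h - P t (A v) x) =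
          l2_norm \<nu> (P t (\<lambda>x. ?q x - A v x))"
        using assms Phv elim by (intro l2_norm_cong P_L2 L2_diff L2_divide) auto
      also have "\<dots> \<le> l2_norm \<nu> (\<lambda>x. ?q x - A v x)"
        using assms Phv elim by (intro P_contraction L2_diff L2_divide) auto
      finally show ?case unfolding Th by simp
    qed
  qed
  then have "P t v \<in> D \<and> ae_eq \<nu> (P t (A v)) (A (P t v))"
    using generator P_L2[OF assms(1) D_L2[OF assms(2)]] P_L2[OF assms(1) A_L2[OF assms(2)]]
    unfolding infinitesimal_generator_def by blast
  then show "P t v \<in> D" "ae_eq \<nu> (P t (A v)) (A (P t v))" by auto
qed

text \<open>Moving \<open>P a\<close> onto u reduces the quotient at time a to the one at time 0.
  The error is therefore uniform in a, as the Riemann sums below require.\<close>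

lemma difference_quotient_along_orbit:
  assumes "0 \<le> a" "0 < h" "u \<in> L2 \<nu>" "v \<in> D"
  shows "\<bar>(l2_inner \<nu> u (P (a + h) v) - l2_inner \<nu> u (P a v)) / h - l2_inner \<nu> u (A (P a v))\<bar> \<le>
    l2_norm \<nu> u * l2_norm \<nu> (\<lambda>x. (T h v x - v x) / h - A v x)"
proof -
  let ?q = "\<lambda>x. (T h v x - v x) / h"
  have Th: "T h = P h" "P h v \<in> L2 \<nu>" using assms by (auto simp: T_eq_P)
  have e: "(\<lambda>x. ?q x - A v x) \<in> L2 \<nu>"
    unfolding Th(1) using assms Th(2) by (intro L2_diff L2_divide) auto
  have "l2_inner \<nu> (P a u) (\<lambda>x. ?q x - A v x) =
      (l2_inner \<nu> (P a u) (P h v) - l2_inner \<nu> (P a u) v) / h - l2_inner \<nu> (P a u) (A v)"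
    unfolding Th(1) using assms Th(2)
    by (simp add: l2_inner_diff_left l2_inner_divide_left L2_diff L2_divide l2_inner_commute[of _ "P a u"])
  also have "l2_inner \<nu> (P a u) (P h v) = l2_inner \<nu> u (P (a + h) v)"
    using assms P_inner_semigroup[of a h u v] P_symmetric[of "a + h" u v] by simp
  also have "l2_inner \<nu> (P a u) v = l2_inner \<nu> u (P a v)"
    using assms by (simp add: P_symmetric)
  also have "l2_inner \<nu> (P a u) (A v) = l2_inner \<nu> u (A (P a v))"
    using assms A_P[of a v] P_D[of a v] P_symmetric[of a u "A v"] by (auto intro!: l2_inner_cong)
  finally have "\<bar>(l2_inner \<nu> u (P (a + h) v) - l2_inner \<nu> u (P a v)) / h - l2_inner \<nu> u (A (P a v))\<bar> \<le>
      l2_norm \<nu> (P a u) * l2_norm \<nu> (\<lambda>x. ?q x - A v x)"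
    using l2_Cauchy_Schwarz[of "P a u" \<nu>, OF _ e] assms by simp
  also have "\<dots> \<le> l2_norm \<nu> u * l2_norm \<nu> (\<lambda>x. ?q x - A v x)"
    using assms by (intro mult_right_mono P_contraction) auto
  finally show ?thesis .
qed

text \<open>
  The discrete form of \<open>(u, v - T\<^sub>s v) = \<integral>\<^sub>0\<^sup>s (B u, B T\<^sub>r v) dr\<close> together with
  \<open>\<integral>\<^sub>0\<^sup>s \<parallel>B T\<^sub>r v\<parallel>\<^sup>2 dr \<le> (v, v - T\<^sub>s v)\<close>.
\<close>

lemma inner_increment_le:
  assumes u: "u \<in> F" and v: "v \<in> D" and s: "0 < s"
  shows "l2_inner \<nu> u v - l2_inner \<nu> u (P s v) \<le> l2_norm \<nu> (B u) * sqrt (s * dissip v s)"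
proof -
  define e where "e h = l2_norm \<nu> (\<lambda>x. (T h v x - v x) / h - A v x)" for h
  define h where "h n = s * inverse (real (Suc n))" for n
  have bound: "l2_inner \<nu> u v - l2_inner \<nu> u (P s v) \<le>
      l2_norm \<nu> (B u) * sqrt (s * (dissip v s + s * (l2_norm \<nu> v * e (h n)))) +
      s * (l2_norm \<nu> u * e (h n))" for n
  proof -
    let ?N = "Suc n" and ?h = "h n"
    have h: "0 < ?h" "real ?N * ?h = s" using s by (auto simp: h_def)
    have e: "0 \<le> e ?h" by (simp add: e_def)
    define w where "w k = P (real k * ?h) v" for k
    have w: "w k \<in> D" for k unfolding w_def using h v by (intro P_D) auto
    define b where "b k = l2_norm \<nu> (B (w k))" for k
    have quot: "\<bar>(l2_inner \<nu> z (w (Suc k)) - l2_inner \<nu> z (w k)) / ?h - l2_inner \<nu> z (A (w k))\<bar> \<le>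
        l2_norm \<nu> z * e ?h" if "z \<in> L2 \<nu>" for z k
      using difference_quotient_along_orbit[of "real k * ?h" ?h z v] h that v
      by (simp add: w_def e_def algebra_simps)
    have step: "l2_inner \<nu> u (w k) - l2_inner \<nu> u (w (Suc k)) \<le>
        ?h * (l2_norm \<nu> (B u) * b k + l2_norm \<nu> u * e ?h)" for k
    proof -
      have "- l2_inner \<nu> u (A (w k)) \<le> l2_norm \<nu> (B u) * b k"
        using l2_Cauchy_Schwarz[of "B u" \<nu> "B (w k)"] u w[of k] by (simp add: inner_A b_def)
      then have "(l2_inner \<nu> u (w k) - l2_inner \<nu> u (w (Suc k))) / ?h \<le>
          l2_norm \<nu> (B u) * b k + l2_norm \<nu> u * e ?h"
        using quot[of u k] u by (simp add: diff_divide_distrib abs_le_iff)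
      then show ?thesis using h by (simp add: divide_le_eq mult.commute)
    qed
    \<comment> \<open>The squared norm of B (w k) is, up to the quotient error, a decrement of
      \<open>corr v\<close> at the doubled time 2 k h. As decrements decrease, the one at k h bounds
      it, and the sum telescopes over [0, s].\<close>
    have energy: "?h * (b k)\<^sup>2 \<le> corr v (real k * ?h) - corr v (real (Suc k) * ?h) +
        ?h * (l2_norm \<nu> v * e ?h)" for k
    proof -
      have "l2_inner \<nu> (w k) (w k) = corr v (real (2 * k) * ?h)"
        using corr_add[of "real k * ?h" "real k * ?h" v] h v by (simp add: w_def algebra_simps)
      moreover have "l2_inner \<nu> (w k) (w (Suc k)) = corr v (real (Suc (2 * k)) * ?h)"
        using corr_add[of "real k * ?h" "real (Suc k) * ?h" v] h v by (simp add: w_def algebra_simps)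
      moreover have "(b k)\<^sup>2 = - l2_inner \<nu> (w k) (A (w k))"
        using w[of k] by (simp add: b_def norm_B_power2 l2_inner_commute)
      ultimately have "(b k)\<^sup>2 \<le> (corr v (real (2 * k) * ?h) - corr v (real (Suc (2 * k)) * ?h)) / ?h +
          l2_norm \<nu> (w k) * e ?h"
        using quot[of "w k" k] w[of k] by (simp add: diff_divide_distrib abs_le_iff)
      moreover have "l2_norm \<nu> (w k) * e ?h \<le> l2_norm \<nu> v * e ?h"
        unfolding w_def using h v e by (intro mult_right_mono P_contraction) auto
      moreover have "corr v (real (2 * k) * ?h) - corr v (real (Suc (2 * k)) * ?h) \<le>
          corr v (real k * ?h) - corr v (real (Suc k) * ?h)"
        using h v by (intro corr_decrement_antimono) auto
      then have "(corr v (real (2 * k) * ?h) - corr v (real (Suc (2 * k)) * ?h)) / ?h \<le>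
          (corr v (real k * ?h) - corr v (real (Suc k) * ?h)) / ?h"
        using h by (intro divide_right_mono) auto
      ultimately have "(b k)\<^sup>2 \<le> (corr v (real k * ?h) - corr v (real (Suc k) * ?h)) / ?h +
          l2_norm \<nu> v * e ?h" by linarith
      then have "?h * (b k)\<^sup>2 \<le> ?h * ((corr v (real k * ?h) - corr v (real (Suc k) * ?h)) / ?h +
          l2_norm \<nu> v * e ?h)"
        using h by (intro mult_left_mono) auto
      then show ?thesis using h by (simp add: distrib_left)
    qed
    have "?h * (\<Sum>k<?N. (b k)\<^sup>2) \<le>
        (\<Sum>k<?N. corr v (real k * ?h) - corr v (real (Suc k) * ?h) + ?h * (l2_norm \<nu> v * e ?h))"
      unfolding sum_distrib_left by (intro sum_mono energy)
    also have "\<dots> = (corr v (real 0 * ?h) - corr v (real ?N * ?h)) + real ?N * (?h * (l2_norm \<nu> v * e ?h))"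
      unfolding sum.distrib sum_lessThan_telescope'[of "\<lambda>k. corr v (real k * ?h)"] by simp
    also have "\<dots> = dissip v s + s * (l2_norm \<nu> v * e ?h)"
      unfolding h(2) mult.assoc[symmetric] using s by (simp add: dissip_eq_corr)
    finally have sum_sq: "?h * (\<Sum>k<?N. (b k)\<^sup>2) \<le> dissip v s + s * (l2_norm \<nu> v * e ?h)" .
    \<comment> \<open>Cauchy-Schwarz against the constant 1; since the N steps of length h add up to
      s, it converts the sum of squares into a bound on the Riemann sum of b.\<close>
    have "(\<Sum>k<?N. b k)\<^sup>2 \<le> real ?N * (\<Sum>k<?N. (b k)\<^sup>2)"
      using Cauchy_Schwarz_ineq_sum[of "\<lambda>_. 1" b "{..<?N}"] by simp
    then have "?h\<^sup>2 * (\<Sum>k<?N. b k)\<^sup>2 \<le> ?h\<^sup>2 * (real ?N * (\<Sum>k<?N. (b k)\<^sup>2))"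
      by (intro mult_left_mono) auto
    also have "\<dots> = (real ?N * ?h) * (?h * (\<Sum>k<?N. (b k)\<^sup>2))"
      by (simp only: power2_eq_square mult_ac)
    also have "\<dots> \<le> s * (dissip v s + s * (l2_norm \<nu> v * e ?h))"
      unfolding h(2) using s sum_sq by (intro mult_left_mono) auto
    finally have sum_b: "?h * (\<Sum>k<?N. b k) \<le> sqrt (s * (dissip v s + s * (l2_norm \<nu> v * e ?h)))"
      by (intro real_le_rsqrt) (simp add: power_mult_distrib)
    have "l2_inner \<nu> u v - l2_inner \<nu> u (P s v) = l2_inner \<nu> u (w 0) - l2_inner \<nu> u (w ?N)"
      unfolding w_def h(2) by simp
    also have "\<dots> = (\<Sum>k<?N. l2_inner \<nu> u (w k) - l2_inner \<nu> u (w (Suc k)))"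
      by (rule sum_lessThan_telescope'[symmetric])
    also have "\<dots> \<le> (\<Sum>k<?N. ?h * (l2_norm \<nu> (B u) * b k + l2_norm \<nu> u * e ?h))"
      by (intro sum_mono step)
    also have "\<dots> = l2_norm \<nu> (B u) * (?h * (\<Sum>k<?N. b k)) + (real ?N * ?h) * (l2_norm \<nu> u * e ?h)"
      unfolding distrib_left sum.distrib sum_distrib_left by (simp add: mult_ac)
    also have "\<dots> \<le> l2_norm \<nu> (B u) * sqrt (s * (dissip v s + s * (l2_norm \<nu> v * e ?h))) +
        s * (l2_norm \<nu> u * e ?h)"
      unfolding h(2) by (intro add_right_mono mult_left_mono sum_b) simp
    finally show ?thesis .
  qed
  \<comment> \<open>Refining the mesh removes the quotient errors because v lies in the domain of
    the generator.\<close>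
  have "h \<longlonglongrightarrow> 0"
    unfolding h_def by (intro tendsto_mult_right_zero LIMSEQ_inverse_real_of_nat)
  then have "filterlim h (at_right 0) sequentially"
    using s by (auto simp: filterlim_at h_def)
  then have e: "(\<lambda>n. e (h n)) \<longlonglongrightarrow> 0"
    unfolding e_def by (rule filterlim_compose[OF generator_limit[OF v]])
  have "(\<lambda>n. l2_norm \<nu> (B u) * sqrt (s * (dissip v s + s * (l2_norm \<nu> v * e (h n)))) +
      s * (l2_norm \<nu> u * e (h n))) \<longlonglongrightarrow>
      l2_norm \<nu> (B u) * sqrt (s * (dissip v s + s * (l2_norm \<nu> v * 0))) + s * (l2_norm \<nu> u * 0)"
    by (intro tendsto_intros e)
  from LIMSEQ_le_const[OF this] show ?thesis using bound by auto
qed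

text \<open>With v = u the preceding estimate would bound \<open>dissip u s\<close> by the norm of B
  u times sqrt (s * dissip u s), and one square root cancels. As u need not lie in D, the estimate
  is applied to approximants from D and passed to the limit.\<close>

lemma dissip_le_form:
  assumes u: "u \<in> F" and s: "0 < s"
  shows "dissip u s \<le> s * (l2_norm \<nu> (B u))\<^sup>2"
proof -
  obtain f where f: "\<And>n. f n \<in> D" "(\<lambda>n. l2_norm \<nu> (\<lambda>x. f n x - u x)) \<longlonglongrightarrow> 0"
    using l2_dense_sequence[OF dense F_L2[OF u]] by blast
  let ?x = "sqrt (dissip u s)" and ?c = "l2_norm \<nu> (B u)"
  have "(\<lambda>n. l2_inner \<nu> (f n) u - l2_inner \<nu> (f n) (P s u)) \<longlonglongrightarrow> l2_inner \<nu> u u - l2_inner \<nu> u (P s u)"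
    using f u s by (intro tendsto_diff tendsto_l2_inner always_eventually) auto
  moreover have "(\<lambda>n. ?c * (sqrt s * (?x + l2_norm \<nu> (\<lambda>x. f n x - u x)))) \<longlonglongrightarrow> ?c * (sqrt s * (?x + 0))"
    using f(2) by (intro tendsto_intros)
  moreover have "l2_inner \<nu> (f n) u - l2_inner \<nu> (f n) (P s u) \<le>
      ?c * (sqrt s * (?x + l2_norm \<nu> (\<lambda>x. f n x - u x)))" for n
  proof -
    have "l2_inner \<nu> (f n) u - l2_inner \<nu> (f n) (P s u) = l2_inner \<nu> u (f n) - l2_inner \<nu> u (P s (f n))"
      using P_symmetric[of s u "f n"] f(1)[of n] u s by (simp add: l2_inner_commute)
    also have "\<dots> \<le> ?c * sqrt (s * dissip (f n) s)"
      by (rule inner_increment_le[OF u f(1) s])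
    \<comment> \<open>The dissipation of f n is replaced by that of u at the price of their L2
      distance, so that the right side converges.\<close>
    also have "\<dots> \<le> ?c * (sqrt s * (?x + l2_norm \<nu> (\<lambda>x. f n x - u x)))"
      unfolding real_sqrt_mult
      using sqrt_dissip_diff[of "f n" u s] f(1)[of n] u s by (intro mult_left_mono) auto
    finally show ?thesis .
  qed
  ultimately have "l2_inner \<nu> u u - l2_inner \<nu> u (P s u) \<le> ?c * (sqrt s * (?x + 0))"
    by (intro LIMSEQ_le) auto
  then have "?x * ?x \<le> ?c * sqrt s * ?x"
    using s u dissip_nonneg[of u s] by (simp add: dissip_def l2_inner_commute)
  then have "?x \<le> ?c * sqrt s"
    using dissip_nonneg[of u s] u s mult_right_le_imp_le[of ?x ?x "?c * sqrt s"]
    by (cases "dissip u s = 0") auto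
  then have "?x\<^sup>2 \<le> (?c * sqrt s)\<^sup>2"
    using dissip_nonneg[of u s] u by (intro power_mono) auto
  then show ?thesis
    using dissip_nonneg[of u s] u s by (simp add: power_mult_distrib mult.commute)
qed

text \<open>On D the upper bound of \<open>dissip_le_form\<close> is attained asymptotically. This
  supplies the lower bounds that make the humps large.\<close>

lemma tendsto_dissip_quotient:
  assumes "v \<in> D"
  shows "((\<lambda>s. dissip v s / s) \<longlongrightarrow> (l2_norm \<nu> (B v))\<^sup>2) (at_right 0)"
proof -
  have "eventually (\<lambda>s. (\<lambda>x. (T s v x - v x) / s) \<in> L2 \<nu>) (at_right 0)"
    using eventually_at_right_less[of 0]
  proof eventually_elim
    case (elim s)
    then have Ts: "T s = P s" "P s v \<in> L2 \<nu>" using assms by (auto simp: T_eq_P)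
    show ?case unfolding Ts(1) using assms Ts(2) by (intro L2_diff L2_divide) auto
  qed
  then have "((\<lambda>s. - l2_inner \<nu> (\<lambda>x. (T s v x - v x) / s) v) \<longlongrightarrow> - l2_inner \<nu> (A v) v) (at_right 0)"
    using assms generator_limit[OF assms] by (intro tendsto_minus tendsto_l2_inner) auto
  moreover have "eventually (\<lambda>s. - l2_inner \<nu> (\<lambda>x. (T s v x - v x) / s) v = dissip v s / s) (at_right 0)"
    using eventually_at_right_less[of 0]
  proof eventually_elim
    case (elim s)
    then have Ts: "T s = P s" "P s v \<in> L2 \<nu>" using assms by (auto simp: T_eq_P)
    have "l2_inner \<nu> (\<lambda>x. (P s v x - v x) / s) v = (l2_inner \<nu> (P s v) v - l2_inner \<nu> v v) / s"
      unfolding l2_inner_divide_left using assms Ts(2) by (simp add: l2_inner_diff_left)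
    then show ?case
      unfolding Ts(1) using elim by (simp add: dissip_def diff_divide_distrib)
  qed
  ultimately show ?thesis
    unfolding norm_B_power2[OF assms] by (rule Lim_transform_eventually)
qed

end

context l2_generated_semigroup
begin

section \<open>Bounded generators\<close>

text \<open>A u is tested against vectors of D approximating A u, which itself need not lie in the
  form domain; the form bound controls both factors of (B f, B u). The contrapositive produces
  vectors of large energy ratio.\<close>

lemma bounded_generator_if_form_bounded:
  assumes C: "\<And>v. v \<in> D \<Longrightarrow> (l2_norm \<nu> (B v))\<^sup>2 \<le> C * (l2_norm \<nu> v)\<^sup>2"
  shows "l2_bounded_operator \<nu> D A"
  unfolding l2_bounded_operator_def
proof (intro exI ballI)
  fix u assume u: "u \<in> D"
  \<comment> \<open>C may be negative, hence the truncation before taking the root.\<close>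
  define c where "c = sqrt (max C 0)"
  have c: "0 \<le> c" "c\<^sup>2 = max C 0" by (simp_all add: c_def)
  have B: "l2_norm \<nu> (B v) \<le> c * l2_norm \<nu> v" if "v \<in> D" for v
  proof (rule power2_le_imp_le)
    have "C * (l2_norm \<nu> v)\<^sup>2 \<le> max C 0 * (l2_norm \<nu> v)\<^sup>2" by (intro mult_right_mono) auto
    then show "(l2_norm \<nu> (B v))\<^sup>2 \<le> (c * l2_norm \<nu> v)\<^sup>2"
      using C[OF that] by (simp add: power_mult_distrib c(2))
  qed (use c in simp)
  obtain f where f: "\<And>n. f n \<in> D" "(\<lambda>n. l2_norm \<nu> (\<lambda>x. f n x - A u x)) \<longlonglongrightarrow> 0"
    using l2_dense_sequence[OF dense A_L2[OF u]] by blast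
  let ?c = "c * c * l2_norm \<nu> u" and ?y = "l2_norm \<nu> (A u)"
  have "(\<lambda>n. l2_inner \<nu> (f n) (A u)) \<longlonglongrightarrow> l2_inner \<nu> (A u) (A u)"
    using f u by (intro tendsto_l2_inner always_eventually) auto
  moreover have "(\<lambda>n. ?c * (?y + l2_norm \<nu> (\<lambda>x. f n x - A u x))) \<longlonglongrightarrow> ?c * (?y + 0)"
    using f(2) by (intro tendsto_intros)
  moreover have "l2_inner \<nu> (f n) (A u) \<le> ?c * (?y + l2_norm \<nu> (\<lambda>x. f n x - A u x))" for n
  proof -
    have "l2_inner \<nu> (f n) (A u) \<le> l2_norm \<nu> (B (f n)) * l2_norm \<nu> (B u)"
      using l2_Cauchy_Schwarz[of "B (f n)" \<nu> "B u"] inner_A[of "f n" u] f(1)[of n] u by simp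
    also have "\<dots> \<le> (c * l2_norm \<nu> (f n)) * (c * l2_norm \<nu> u)"
      using B[OF f(1)] B[OF u] c by (intro mult_mono) auto
    also have "\<dots> = ?c * l2_norm \<nu> (f n)" by simp
    also have "l2_norm \<nu> (f n) \<le> ?y + l2_norm \<nu> (\<lambda>x. f n x - A u x)"
      using l2_norm_triangle[of "A u" \<nu> "\<lambda>x. f n x - A u x"] f(1)[of n] u by (simp add: L2_diff)
    then have "?c * l2_norm \<nu> (f n) \<le> ?c * (?y + l2_norm \<nu> (\<lambda>x. f n x - A u x))"
      using c by (intro mult_left_mono) auto
    finally show ?thesis .
  qed
  ultimately have "l2_inner \<nu> (A u) (A u) \<le> ?c * (?y + 0)"
    by (intro LIMSEQ_le) auto
  then have "?y * ?y \<le> ?c * ?y"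
    by (simp add: l2_norm_power2[symmetric] power2_eq_square)
  then show "?y \<le> c * c * l2_norm \<nu> u"
    using mult_right_le_imp_le[of ?y ?y ?c] l2_norm_nonneg[of \<nu> "A u"] c
    by (cases "?y = 0") auto
qed

text \<open>A bound on A makes the form norm comparable to the L2 norm on the dense set D. An L2
  approximating sequence from D is then Cauchy for the form, and its limit in F agrees almost
  everywhere with the given function.\<close>

lemma form_domain_eq_L2_if_bounded:
  assumes closed: "closed_form \<nu> E F"
    and E: "\<And>u v. u \<in> F \<Longrightarrow> v \<in> F \<Longrightarrow> E u v = l2_inner \<nu> (B u) (B v)"
    and bounded: "l2_bounded_operator \<nu> D A"
  shows "F = L2 \<nu>"
proof (intro equalityI subsetI)
  fix u assume u: "u \<in> L2 \<nu>"
  obtain C0 where C0: "\<And>v. v \<in> D \<Longrightarrow> l2_norm \<nu> (A v) \<le> C0 * l2_norm \<nu> v"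
    using bounded by (auto simp: l2_bounded_operator_def)
  define C where "C = max C0 0"
  have C: "l2_norm \<nu> (A v) \<le> C * l2_norm \<nu> v" if "v \<in> D" for v
    using C0[OF that] mult_right_mono[of C0 C "l2_norm \<nu> v"] by (simp add: C_def)
  have norm1: "form_norm1_sq \<nu> E v \<le> (C + 1) * (l2_norm \<nu> v)\<^sup>2" if v: "v \<in> D" for v
  proof -
    have "E v v = - l2_inner \<nu> (A v) v"
      using E[of v v] norm_B_power2[OF v] v by (simp add: l2_norm_power2)
    also have "\<dots> \<le> l2_norm \<nu> (A v) * l2_norm \<nu> v"
      using l2_Cauchy_Schwarz[of "A v" \<nu> v] v by simp
    also have "\<dots> \<le> C * l2_norm \<nu> v * l2_norm \<nu> v"
      using C[OF v] by (intro mult_right_mono) auto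
    finally show ?thesis
      unfolding form_norm1_sq_def l2_norm_power2[symmetric]
      by (simp add: power2_eq_square algebra_simps)
  qed
  obtain f where f: "\<And>n. f n \<in> D" "(\<lambda>n. l2_norm \<nu> (\<lambda>x. f n x - u x)) \<longlonglongrightarrow> 0"
    using l2_dense_sequence[OF dense u] by blast
  have "\<exists>N. \<forall>m\<ge>N. \<forall>n\<ge>N. form_norm1_sq \<nu> E (\<lambda>x. f m x - f n x) < \<epsilon>" if "0 < \<epsilon>" for \<epsilon>
  proof -
    \<comment> \<open>Two terms within r of u are within 2r of each other, and (C + 1) (2r)^2 =
      \<epsilon>.\<close>
    define r where "r = sqrt (\<epsilon> / (C + 1)) / 2"
    have "0 < C + 1" by (simp add: C_def add_nonneg_pos)
    then have r: "0 < r" "(C + 1) * (2 * r)\<^sup>2 = \<epsilon>" using that by (simp_all add: r_def)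
    obtain N where N: "\<And>n. n \<ge> N \<Longrightarrow> l2_norm \<nu> (\<lambda>x. f n x - u x) < r"
      using order_tendstoD(2)[OF f(2) r(1)] by (auto simp: eventually_sequentially)
    have "form_norm1_sq \<nu> E (\<lambda>x. f m x - f n x) < \<epsilon>" if mn: "m \<ge> N" "n \<ge> N" for m n
    proof -
      have "l2_norm \<nu> (\<lambda>x. f m x - f n x) \<le>
          l2_norm \<nu> (\<lambda>x. f m x - u x) + l2_norm \<nu> (\<lambda>x. u x - f n x)"
        using f(1) u by (intro l2_norm_triangle_diff) auto
      also have "\<dots> < 2 * r"
        using N[OF mn(1)] N[OF mn(2)] by (simp add: l2_norm_minus_commute[of \<nu> u])
      finally have "(l2_norm \<nu> (\<lambda>x. f m x - f n x))\<^sup>2 < (2 * r)\<^sup>2"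
        by (intro power_strict_mono) auto
      then have "(C + 1) * (l2_norm \<nu> (\<lambda>x. f m x - f n x))\<^sup>2 < (C + 1) * (2 * r)\<^sup>2"
        using \<open>0 < C + 1\<close> by simp
      then show ?thesis
        using norm1[OF l2_subspace_diff[OF D_subspace f(1)[of m] f(1)[of n]]] r(2) by linarith
    qed
    then show ?thesis by blast
  qed
  moreover have "f n \<in> F" for n using f(1) by simp
  ultimately obtain v where v: "v \<in> F" "(\<lambda>n. form_norm1_sq \<nu> E (\<lambda>x. f n x - v x)) \<longlonglongrightarrow> 0"
    using closed unfolding closed_form_def by blast
  have "(\<lambda>n. (l2_norm \<nu> (\<lambda>x. f n x - v x))\<^sup>2) \<longlonglongrightarrow> 0"
  proof (rule Lim_null_comparison[OF always_eventually[OF allI] v(2)])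
    fix n
    have fv: "(\<lambda>x. f n x - v x) \<in> F"
      using f(1)[of n] v(1) by (intro l2_subspace_diff[OF F_subspace]) auto
    then show "norm ((l2_norm \<nu> (\<lambda>x. f n x - v x))\<^sup>2) \<le> form_norm1_sq \<nu> E (\<lambda>x. f n x - v x)"
      using E[OF fv fv] by (simp add: form_norm1_sq_def l2_norm_power2)
  qed
  then have "(\<lambda>n. sqrt ((l2_norm \<nu> (\<lambda>x. f n x - v x))\<^sup>2)) \<longlonglongrightarrow> sqrt 0"
    by (rule tendsto_real_sqrt)
  then have fv: "(\<lambda>n. l2_norm \<nu> (\<lambda>x. f n x - v x)) \<longlonglongrightarrow> 0" by simp
  have "l2_norm \<nu> (\<lambda>x. v x - u x) \<le> 0 + 0"
  proof (rule LIMSEQ_le_const[OF tendsto_add[OF fv f(2)]], intro exI allI impI)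
    fix n
    show "l2_norm \<nu> (\<lambda>x. v x - u x) \<le> l2_norm \<nu> (\<lambda>x. f n x - v x) + l2_norm \<nu> (\<lambda>x. f n x - u x)"
      using l2_norm_triangle_diff[of v \<nu> "f n" u] v(1) f(1)[of n] u
      by (simp add: l2_norm_minus_commute[of \<nu> v "f n"])
  qed
  then have "ae_eq \<nu> v u"
    using v(1) u l2_norm_nonneg[of \<nu> "\<lambda>x. v x - u x"] by (intro ae_eq_if_l2_norm_diff_zero) auto
  then show "u \<in> F"
    using l2_subspace_ae_eq[OF F_subspace v(1) u] by blast
qed simp

section \<open>A gliding hump for unbounded generators\<close>

text \<open>
  The last condition makes the \<open>\<delta>\<close>-energy of \<open>w\<close> summable in \<open>n\<close> from the index \<open>1 / (1 - \<delta>)\<close> on, so that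
  one sequence of increments serves all \<open>\<delta> < 1\<close>.
\<close>

definition tame_increment :: "nat \<Rightarrow> ('a \<Rightarrow> real) \<Rightarrow> bool" where
  "tame_increment n w \<longleftrightarrow> (\<exists>c K. 0 < c \<and> 0 \<le> K \<and> (\<forall>s>0. dissip w s \<le> K * min 1 (c * s)) \<and>
     (\<forall>\<delta>. \<delta> < 1 \<and> 1 / (1 - \<delta>) \<le> real (Suc n) \<longrightarrow> K * c powr \<delta> \<le> (1 / 4) ^ n))"

text \<open>One stage of the construction: \<rho> limits the present change, s is a time at which
  the new sum has large dissipation, and \<rho>' is small enough that later changes do not undo
  this.\<close>

lemma hump_step:
  assumes unbounded: "\<And>C. \<exists>v\<in>D. C * (l2_norm \<nu> v)\<^sup>2 < (l2_norm \<nu> (B v))\<^sup>2"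
    and S: "S \<in> D" and \<rho>: "0 < \<rho>"
  obtains S' \<rho>' s where "S' \<in> D" "0 < \<rho>'" "2 * \<rho>' \<le> \<rho>" "l2_norm \<nu> (\<lambda>x. S' x - S x) \<le> \<rho>"
    "tame_increment n (\<lambda>x. S' x - S x)"
    "0 < s" "real (Suc n) * sqrt s \<le> sqrt (dissip S' s)" "2 * \<rho>' \<le> sqrt s"
proof -
  \<comment> \<open>The gap between k and n + 1 leaves room to pass from the limit of a difference
    quotient to its value at a positive time s.\<close>
  define k where "k = real n + 2"
  have k: "real (Suc n) < k" "0 < k" by (simp_all add: k_def)
  \<comment> \<open>The energy ratio c of v will exceed L. The bound 1 serves monotonicity of powers
    of c, the second bound the \<delta>-energy, and the third the L2 norm of the hump.\<close>
  define L where "L = max 1 (max ((k\<^sup>2 * 4 ^ n) ^ Suc n) (k\<^sup>2 / \<rho>\<^sup>2))"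
  obtain v where v: "v \<in> D" "L * (l2_norm \<nu> v)\<^sup>2 < (l2_norm \<nu> (B v))\<^sup>2"
    using unbounded by blast
  define b where "b = l2_norm \<nu> (B v)"
  have "0 \<le> L * (l2_norm \<nu> v)\<^sup>2" by (simp add: L_def)
  then have "b \<noteq> 0" using v(2) by (auto simp: b_def)
  then have b: "0 < b" using l2_norm_nonneg[of \<nu> "B v"] unfolding b_def by linarith
  have quotient: "((\<lambda>s. dissip v s / s) \<longlongrightarrow> b\<^sup>2) (at_right 0)"
    using tendsto_dissip_quotient[OF v(1)] by (simp add: b_def)
  \<comment> \<open>A vector of norm zero has no dissipation, against the positive limit
    b^2.\<close>
  have "l2_norm \<nu> v \<noteq> 0"
  proof
    assume "l2_norm \<nu> v = 0"
    then have "dissip v s = 0" for s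
      using dissip_le_norm[of v s] dissip_nonneg[of v s] v(1) by simp
    then have "((\<lambda>s. 0) \<longlongrightarrow> b\<^sup>2) (at_right (0::real))" using quotient by simp
    then have "b\<^sup>2 = 0" by (simp add: tendsto_const_iff trivial_limit_at_right_real)
    then show False using b by simp
  qed
  then have v_pos: "0 < l2_norm \<nu> v" using l2_norm_nonneg[of \<nu> v] by linarith
  define c where "c = b\<^sup>2 / (l2_norm \<nu> v)\<^sup>2"
  have "L < c" using v(2) v_pos by (simp add: c_def b_def field_simps)
  then have c: "1 < c" "(k\<^sup>2 * 4 ^ n) ^ Suc n < c" "k\<^sup>2 / \<rho>\<^sup>2 < c"
    unfolding L_def by (simp_all only: max_less_iff_conj)
  \<comment> \<open>The scaling makes \<open>dissip w s / s\<close> tend to k^2 as s tends to 0,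
    while the squared norm becomes k^2 / c.\<close>
  define w where "w = (\<lambda>x. (k / b) * v x)"
  have w: "w \<in> D" unfolding w_def by (intro D_scale v)
  have dissip_w: "dissip w s = (k / b)\<^sup>2 * dissip v s" for s
    unfolding w_def using v(1) by (intro dissip_scale) simp
  have "(l2_norm \<nu> w)\<^sup>2 = k\<^sup>2 / c"
    unfolding w_def l2_norm_scale using b v_pos by (simp add: power_mult_distrib power_divide c_def)
  also have "\<dots> \<le> \<rho>\<^sup>2" using c(1,3) \<rho> by (simp add: field_simps)
  finally have norm_w: "l2_norm \<nu> w \<le> \<rho>" by (rule power2_le_imp_le) (use \<rho> in simp)
  \<comment> \<open>The form bound is used below s = 1 / c and the norm bound from there on.\<close>
  have tame_w: "dissip w s \<le> (k\<^sup>2 / c) * min 1 (c * s)" if "0 < s" for s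
  proof -
    have "dissip v s \<le> (l2_norm \<nu> v)\<^sup>2 * min 1 (c * s)"
    proof (cases "1 \<le> c * s")
      case True
      then show ?thesis using dissip_le_norm[of v s] v(1) by simp
    next
      case False
      have "dissip v s \<le> s * b\<^sup>2"
        unfolding b_def using v(1) that by (intro dissip_le_form) auto
      also have "\<dots> = (l2_norm \<nu> v)\<^sup>2 * (c * s)" using v_pos by (simp add: c_def)
      finally show ?thesis using False by simp
    qed
    then have "dissip w s \<le> (k / b)\<^sup>2 * ((l2_norm \<nu> v)\<^sup>2 * min 1 (c * s))"
      unfolding dissip_w by (intro mult_left_mono) auto
    also have "\<dots> = (k\<^sup>2 / c) * min 1 (c * s)"
      by (simp add: c_def power_divide)
    finally show ?thesis .
  qed
  \<comment> \<open>The claim amounts to k^2 4^n <= c^(1 - \<delta>). The condition on n gives 1 -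
    \<delta> >= 1 / (n + 1), and c exceeds (k^2 4^n)^(n + 1).\<close>
  have small: "k\<^sup>2 / c * c powr \<delta> \<le> (1 / 4) ^ n" if "\<delta> < 1" "1 / (1 - \<delta>) \<le> real (Suc n)" for \<delta>
  proof -
    have "1 / real (Suc n) \<le> 1 - \<delta>" using that by (simp add: field_simps)
    have "k\<^sup>2 * 4 ^ n = ((k\<^sup>2 * 4 ^ n) powr real (Suc n)) powr (1 / real (Suc n))"
      using k by (simp add: powr_powr)
    also have "\<dots> \<le> c powr (1 / real (Suc n))"
      using c(2) k by (intro powr_mono2) (auto simp: powr_realpow simp del: power_Suc of_nat_Suc)
    also have "\<dots> \<le> c powr (1 - \<delta>)"
      using c(1) \<open>1 / real (Suc n) \<le> 1 - \<delta>\<close> by (intro powr_mono) auto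
    also have "\<dots> = c / c powr \<delta>" using c(1) by (simp add: powr_diff)
    finally show ?thesis using c(1) by (simp add: field_simps power_divide)
  qed
  have "(real (Suc n))\<^sup>2 * b\<^sup>2 / k\<^sup>2 < b\<^sup>2"
    using k b by (simp add: field_simps power_strict_mono del: of_nat_Suc)
  then have "eventually (\<lambda>s. (real (Suc n))\<^sup>2 * b\<^sup>2 / k\<^sup>2 < dissip v s / s \<and> 0 < s) (at_right 0)"
    using order_tendstoD(1)[OF quotient] eventually_at_right_less[of 0] by (auto intro: eventually_conj)
  then obtain s where s: "0 < s" "(real (Suc n))\<^sup>2 * b\<^sup>2 / k\<^sup>2 < dissip v s / s"
    using eventually_happens'[OF trivial_limit_at_right_real] by blast
  have "(real (Suc n))\<^sup>2 * s \<le> dissip w s"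
    unfolding dissip_w using s k b by (simp add: field_simps del: of_nat_Suc)
  then have "sqrt ((real (Suc n))\<^sup>2 * s) \<le> sqrt (dissip w s)" by simp
  then have big: "real (Suc n) * sqrt s \<le> sqrt (dissip w s)"
    by (simp add: real_sqrt_mult)
  \<comment> \<open>2 w is the difference of S + w and S - w, so for one of the signs the new sum
    dissipates at least as much as w alone and cancellation with S is avoided.\<close>
  have "2 * sqrt (dissip w s) = sqrt (dissip (\<lambda>x. (S x + w x) + (-1) * (S x - w x)) s)"
    using dissip_scale[of w 2 s] w by (simp add: real_sqrt_mult)
  also have "\<dots> \<le> sqrt (dissip (\<lambda>x. S x + w x) s) + sqrt (dissip (\<lambda>x. (-1) * (S x - w x)) s)"
    using S w by (intro sqrt_dissip_triangle L2_add L2_scale L2_diff) auto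
  also have "dissip (\<lambda>x. (-1) * (S x - w x)) s = dissip (\<lambda>x. S x - w x) s"
    using S w by (subst dissip_scale) auto
  finally consider "sqrt (dissip w s) \<le> sqrt (dissip (\<lambda>x. S x + w x) s)"
    | "sqrt (dissip w s) \<le> sqrt (dissip (\<lambda>x. S x - w x) s)"
    by linarith
  then obtain \<sigma> :: real where \<sigma>: "\<bar>\<sigma>\<bar> = 1" "sqrt (dissip w s) \<le> sqrt (dissip (\<lambda>x. S x + \<sigma> * w x) s)"
  proof cases
    case 1
    then show ?thesis using that[of 1] by simp
  next
    case 2
    then show ?thesis using that[of "-1"] by simp
  qed
  show ?thesis
  proof
    show "(\<lambda>x. S x + \<sigma> * w x) \<in> D" using S w by (intro D_add D_scale)
    \<comment> \<open>Halving \<rho> keeps the steps geometric; the second bound keeps the total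
      later change, at most twice the new scale, within sqrt s.\<close>
    show "0 < min (\<rho> / 2) (sqrt s / 2)" using \<rho> s by simp
    show "2 * min (\<rho> / 2) (sqrt s / 2) \<le> \<rho>" "2 * min (\<rho> / 2) (sqrt s / 2) \<le> sqrt s"
      by linarith+
    show "l2_norm \<nu> (\<lambda>x. S x + \<sigma> * w x - S x) \<le> \<rho>"
      using norm_w \<sigma>(1) by (simp add: l2_norm_scale)
    have "\<sigma>\<^sup>2 = 1" using \<sigma>(1) by (simp add: power2_eq_1_iff abs_eq_iff')
    then have "dissip (\<lambda>x. \<sigma> * w x) s = dissip w s" for s
      using w by (subst dissip_scale) auto
    then show "tame_increment n (\<lambda>x. S x + \<sigma> * w x - S x)"
      unfolding tame_increment_def using c(1) tame_w small
      by (intro exI[of _ c] exI[of _ "k\<^sup>2 / c"] conjI allI impI) simp_all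
    show "0 < s" by (rule s)
    show "real (Suc n) * sqrt s \<le> sqrt (dissip (\<lambda>x. S x + \<sigma> * w x) s)"
      using big \<sigma>(2) by linarith
  qed
qed

text \<open>At the time s of stage n the limit u keeps a root of dissipation of at least n sqrt s,
  whereas membership in F would cap it at the norm of B u times sqrt s, for every n.\<close>

lemma gliding_hump:
  assumes unbounded: "\<And>C. \<exists>v\<in>D. C * (l2_norm \<nu> v)\<^sup>2 < (l2_norm \<nu> (B v))\<^sup>2"
  obtains u S where "u \<in> L2 \<nu>" "u \<notin> F" "\<And>n. S n \<in> D"
    "(\<lambda>n. l2_norm \<nu> (\<lambda>x. u x - S n x)) \<longlonglongrightarrow> 0"
    "\<And>n. tame_increment n (\<lambda>x. S (Suc n) x - S n x)"
proof -
  \<comment> \<open>p and q are consecutive pairs of a partial sum and the scale allowed for the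
    next change.\<close>
  let ?Q = "\<lambda>n p q. 2 * snd q \<le> snd p \<and> l2_norm \<nu> (\<lambda>x. fst q x - fst p x) \<le> snd p \<and>
      tame_increment n (\<lambda>x. fst q x - fst p x) \<and>
      (\<exists>s>0. real (Suc n) * sqrt s \<le> sqrt (dissip (fst q) s) \<and> 2 * snd q \<le> sqrt s)"
  have "\<exists>f. \<forall>n. (fst (f n) \<in> D \<and> 0 < snd (f n)) \<and> ?Q n (f n) (f (Suc n))"
  proof (rule dependent_nat_choice)
    show "\<exists>x :: ('a \<Rightarrow> real) \<times> real. fst x \<in> D \<and> 0 < snd x"
      using D_zero by (intro exI[of _ "((\<lambda>_. 0), 1)"]) simp
    fix x :: "('a \<Rightarrow> real) \<times> real" and n assume x: "fst x \<in> D \<and> 0 < snd x"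
    obtain S' \<rho>' s where "S' \<in> D" "0 < \<rho>'" "2 * \<rho>' \<le> snd x" "l2_norm \<nu> (\<lambda>y. S' y - fst x y) \<le> snd x"
      "tame_increment n (\<lambda>y. S' y - fst x y)"
      "0 < s" "real (Suc n) * sqrt s \<le> sqrt (dissip S' s)" "2 * \<rho>' \<le> sqrt s"
      by (rule hump_step[OF unbounded conjunct1[OF x] conjunct2[OF x]])
    then show "\<exists>y. (fst y \<in> D \<and> 0 < snd y) \<and> ?Q n x y"
      by (intro exI[of _ "(S', \<rho>')"]) auto
  qed
  then obtain f where f: "\<And>n. fst (f n) \<in> D" "\<And>n. 0 < snd (f n)" "\<And>n. ?Q n (f n) (f (Suc n))"
    by blast
  define S where "S n = fst (f n)" for n
  define \<rho> where "\<rho> n = snd (f n)" for n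
  have S: "S n \<in> D" for n using f(1) by (simp add: S_def)
  have \<rho>_half: "2 * \<rho> (Suc n) \<le> \<rho> n" and step: "l2_norm \<nu> (\<lambda>x. S (Suc n) x - S n x) \<le> \<rho> n"
    and tame: "tame_increment n (\<lambda>x. S (Suc n) x - S n x)"
    and big: "\<exists>s>0. real (Suc n) * sqrt s \<le> sqrt (dissip (S (Suc n)) s) \<and> 2 * \<rho> (Suc n) \<le> sqrt s" for n
    using f(3)[of n] unfolding S_def \<rho>_def by blast+
  obtain u where u: "u \<in> L2 \<nu>" "\<And>n. l2_norm \<nu> (\<lambda>x. u x - S n x) \<le> 2 * \<rho> n"
    using L2_limit_of_geometric[of S \<nu> \<rho>] S step \<rho>_half by auto
  have \<rho>_le: "\<rho> n \<le> \<rho> 0 * (1 / 2) ^ n" for n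
  proof (induction n)
    case (Suc n)
    then show ?case using \<rho>_half[of n] by simp
  qed simp
  have lim: "(\<lambda>n. l2_norm \<nu> (\<lambda>x. u x - S n x)) \<longlonglongrightarrow> 0"
  proof (rule Lim_null_comparison)
    show "(\<lambda>n. 2 * (\<rho> 0 * (1 / 2) ^ n)) \<longlonglongrightarrow> 0"
      by (intro tendsto_mult_right_zero LIMSEQ_power_zero) simp
    show "eventually (\<lambda>n. norm (l2_norm \<nu> (\<lambda>x. u x - S n x)) \<le> 2 * (\<rho> 0 * (1 / 2) ^ n)) sequentially"
    proof (intro always_eventually allI)
      fix n
      show "norm (l2_norm \<nu> (\<lambda>x. u x - S n x)) \<le> 2 * (\<rho> 0 * (1 / 2) ^ n)"
        using u(2)[of n] \<rho>_le[of n] by simp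
    qed
  qed
  have "u \<notin> F"
  proof
    assume uF: "u \<in> F"
    let ?c = "l2_norm \<nu> (B u)"
    \<comment> \<open>The later humps cost at most sqrt s, which accounts for n in place of n +
      1.\<close>
    have "real n \<le> ?c" for n
    proof -
      obtain s where s: "0 < s" "real (Suc n) * sqrt s \<le> sqrt (dissip (S (Suc n)) s)"
        "2 * \<rho> (Suc n) \<le> sqrt s" using big by blast
      note s(2)
      also have "sqrt (dissip (S (Suc n)) s) \<le> sqrt (dissip u s) + l2_norm \<nu> (\<lambda>x. S (Suc n) x - u x)"
        using S u(1) by (intro sqrt_dissip_diff) auto
      also have "\<dots> \<le> sqrt (s * ?c\<^sup>2) + sqrt s"
        using dissip_le_form[OF uF s(1)] u(2)[of "Suc n"] s(3)
        by (intro add_mono) (auto simp: l2_norm_minus_commute[of \<nu> _ u])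
      also have "\<dots> = (?c + 1) * sqrt s"
        using s by (simp add: real_sqrt_mult algebra_simps)
      finally show ?thesis using s(1) by simp
    qed
    then show False using reals_Archimedean2[of ?c] by (meson not_le)
  qed
  then show ?thesis using that u(1) S lim tame by blast
qed

end

section \<open>Membership in the form domain of a fixed index\<close>

locale subordinated_generated_semigroup =
  l2_generated_semigroup \<nu> T D A F B + subordinated_l2_semigroup \<nu> T \<delta> M \<xi> \<eta> T'
  for \<nu> :: "'a measure" and T D A F B \<delta> and M :: "'b measure" and \<xi> \<eta> T'
begin

text \<open>This is \<open>mean_dissip_le\<close> with c = 1: the norm bound serves s >= 1 and the
  form bound s < 1.\<close>

lemma mean_dissip_le_form:
  assumes "u \<in> F" "0 < t"
  shows "mean_dissip u t \<le> 2 * max ((l2_norm \<nu> u)\<^sup>2) ((l2_norm \<nu> (B u))\<^sup>2) * t"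
proof -
  let ?K = "max ((l2_norm \<nu> u)\<^sup>2) ((l2_norm \<nu> (B u))\<^sup>2)"
  have "dissip u s \<le> ?K * min 1 (1 * s)" if "0 < s" for s
  proof (cases "1 \<le> s")
    case True
    then show ?thesis using dissip_le_norm[of u s] assms by (simp add: max.coboundedI1)
  next
    case False
    have "dissip u s \<le> (l2_norm \<nu> (B u))\<^sup>2 * s"
      using dissip_le_form[OF assms(1) that] by (simp add: mult.commute)
    also have "\<dots> \<le> ?K * s" using that by (intro mult_right_mono) auto
    finally show ?thesis using False by simp
  qed
  then show ?thesis
    using mean_dissip_le[of u t 1 ?K] assms by (simp add: max.coboundedI1)
qed

lemma form_domain_subset: "F \<subseteq> semigroup_form_domain \<nu> T'"
  using mean_dissip_le_form by (auto intro!: semigroup_form_domainI)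

text \<open>At fixed t the square root of \<open>mean_dissip\<close> obeys the triangle inequality
  and is dominated by the L2 norm, so bounds add up along the increments and survive the limit.
  Apart from the factor sqrt t they do not depend on t.\<close>

lemma limit_of_tame_increments_in_domain:
  assumes u: "u \<in> L2 \<nu>" and S: "\<And>n. S n \<in> D"
    and lim: "(\<lambda>n. l2_norm \<nu> (\<lambda>x. u x - S n x)) \<longlonglongrightarrow> 0"
    and tame: "\<And>n. tame_increment n (\<lambda>x. S (Suc n) x - S n x)"
  shows "u \<in> semigroup_form_domain \<nu> T'"
proof -
  \<comment> \<open>From N on the tame bound covers this \<delta>. The earlier stages are absorbed
    into S N, whose energy is finite because it lies in D.\<close>
  obtain N :: nat where N: "1 / (1 - \<delta>) \<le> real N" using real_arch_simple by blast
  define C where "C = 2 * max ((l2_norm \<nu> (S N))\<^sup>2) ((l2_norm \<nu> (B (S N)))\<^sup>2)"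
  have "0 \<le> C" by (simp add: C_def max.coboundedI1)
  have increment: "sqrt (mean_dissip (\<lambda>x. S (Suc n) x - S n x) t) \<le> 2 * (1 / 2) ^ n * sqrt t"
    if "N \<le> n" "0 < t" for n t
  proof -
    obtain c K where cK: "0 < c" "0 \<le> K"
      "\<And>s. 0 < s \<Longrightarrow> dissip (\<lambda>x. S (Suc n) x - S n x) s \<le> K * min 1 (c * s)"
      "\<delta> < 1 \<and> 1 / (1 - \<delta>) \<le> real (Suc n) \<longrightarrow> K * c powr \<delta> \<le> (1 / 4) ^ n"
      using tame[of n] unfolding tame_increment_def by blast
    have "K * c powr \<delta> \<le> (1 / 4) ^ n"
      using cK(4) \<delta> N that(1) by auto
    \<comment> \<open>The factor 2 is enlarged to 4 so that the bound becomes the square of 2 * 2^-n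
      * sqrt t.\<close>
    then have "2 * (K * c powr \<delta>) \<le> 4 * (1 / 4) ^ n"
      using zero_le_power[of "1 / 4 :: real" n] by linarith
    then have "2 * (K * c powr \<delta>) * t \<le> 4 * (1 / 4) ^ n * t"
      using that by (intro mult_right_mono) auto
    moreover have "mean_dissip (\<lambda>x. S (Suc n) x - S n x) t \<le> 2 * (K * c powr \<delta>) * t"
      using mean_dissip_le[of "\<lambda>x. S (Suc n) x - S n x" t c K] S cK that
      by (simp add: L2_diff mult.assoc)
    moreover have "4 * (1 / 4) ^ n * t = (2 * (1 / 2) ^ n * sqrt t)\<^sup>2"
      using that by (simp add: power_mult_distrib power_divide power2_eq_square flip: power_mult_distrib)
    ultimately have "mean_dissip (\<lambda>x. S (Suc n) x - S n x) t \<le> (2 * (1 / 2) ^ n * sqrt t)\<^sup>2"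
      by linarith
    then show ?thesis using that by (intro real_le_lsqrt) simp_all
  qed
  have "mean_dissip u t \<le> (sqrt C + 4)\<^sup>2 * t" if t: "0 < t" for t
  proof -
    \<comment> \<open>4 (1 - 2^-k) is the sum of 2 * 2^-j over j < k; the surplus factor 2^-N is
      discarded.\<close>
    have partial: "sqrt (mean_dissip (S (N + k)) t) \<le> sqrt (C * t) + 4 * sqrt t * (1 - (1 / 2) ^ k)" for k
    proof (induction k)
      case 0
      then show ?case using mean_dissip_le_form[of "S N" t] S t by (simp add: C_def)
    next
      case (Suc k)
      have "sqrt (mean_dissip (S (N + Suc k)) t) \<le> sqrt (mean_dissip (S (N + k)) t) +
          sqrt (mean_dissip (\<lambda>x. S (Suc (N + k)) x - S (N + k) x) t)"
        using sqrt_mean_dissip_triangle[of "S (N + k)" "\<lambda>x. S (Suc (N + k)) x - S (N + k) x" t] S t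
        by (simp add: L2_diff)
      moreover have "2 * (1 / 2) ^ (N + k) * sqrt t \<le> 2 * (1 / 2) ^ k * sqrt t"
        using t by (intro mult_right_mono mult_left_mono power_decreasing) auto
      moreover have "4 * sqrt t * (1 - (1 / 2) ^ Suc k) = 4 * sqrt t * (1 - (1 / 2) ^ k) + 2 * (1 / 2) ^ k * sqrt t"
        by (simp add: algebra_simps)
      ultimately show ?case
        using Suc increment[OF le_add1 t, of k] by linarith
    qed
    have "sqrt (mean_dissip u t) \<le> sqrt (C * t) + 4 * sqrt t + l2_norm \<nu> (\<lambda>x. u x - S (N + k) x)" for k
    proof -
      have "sqrt (mean_dissip u t) \<le>
          sqrt (mean_dissip (S (N + k)) t) + sqrt (mean_dissip (\<lambda>x. u x - S (N + k) x) t)"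
        using sqrt_mean_dissip_triangle[of "S (N + k)" "\<lambda>x. u x - S (N + k) x" t] S u t
        by (simp add: L2_diff)
      moreover have "sqrt (mean_dissip (\<lambda>x. u x - S (N + k) x) t) \<le> l2_norm \<nu> (\<lambda>x. u x - S (N + k) x)"
        using u S t by (intro sqrt_mean_dissip_le_norm L2_diff) auto
      moreover have "4 * sqrt t * (1 - (1 / 2) ^ k) \<le> 4 * sqrt t * 1"
        using t by (intro mult_left_mono) auto
      ultimately show ?thesis using partial[of k] by linarith
    qed
    moreover have "(\<lambda>k. l2_norm \<nu> (\<lambda>x. u x - S (N + k) x)) \<longlonglongrightarrow> 0"
      using LIMSEQ_ignore_initial_segment[OF lim, of N] by (simp add: add.commute)
    then have "(\<lambda>k. sqrt (C * t) + 4 * sqrt t + l2_norm \<nu> (\<lambda>x. u x - S (N + k) x)) \<longlonglongrightarrow>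
        sqrt (C * t) + 4 * sqrt t + 0"
      by (intro tendsto_add tendsto_const)
    ultimately have "sqrt (mean_dissip u t) \<le> sqrt (C * t) + 4 * sqrt t + 0"
      by (intro LIMSEQ_le_const) auto
    also have "\<dots> = (sqrt C + 4) * sqrt t" by (simp add: real_sqrt_mult algebra_simps)
    finally have "(sqrt (mean_dissip u t))\<^sup>2 \<le> ((sqrt C + 4) * sqrt t)\<^sup>2"
      using mean_dissip_nonneg[OF u] by (intro power_mono) auto
    then show ?thesis
      using mean_dissip_nonneg[OF u] t by (simp add: power_mult_distrib)
  qed
  then show ?thesis using u by (intro semigroup_form_domainI) auto
qed

end

section \<open>The intersection of the subordinated form domains\<close>

theorem theorem1p5:
  fixes \<nu> :: "'a::metric_space measure"
    and E :: "('a \<Rightarrow> real) \<Rightarrow> ('a \<Rightarrow> real) \<Rightarrow> real" and F :: "('a \<Rightarrow> real) set"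
    and A :: "('a \<Rightarrow> real) \<Rightarrow> 'a \<Rightarrow> real" and D :: "('a \<Rightarrow> real) set"
    and T :: "real \<Rightarrow> ('a \<Rightarrow> real) \<Rightarrow> 'a \<Rightarrow> real"
    and W :: "'w measure" and P :: "'a option \<Rightarrow> 'w measure"
    and X :: "ennreal \<Rightarrow> 'w \<Rightarrow> 'a option"
    and M :: "real \<Rightarrow> 'b measure" and \<xi> :: "real \<Rightarrow> real \<Rightarrow> 'b \<Rightarrow> real"
    and \<eta> :: "real \<Rightarrow> real \<Rightarrow> real \<Rightarrow> real"
    and T\<^sub>\<delta> :: "real \<Rightarrow> real \<Rightarrow> ('a \<Rightarrow> real) \<Rightarrow> 'a \<Rightarrow> real"
  assumes "metric_measure_space \<nu>"
    and "regular_dirichlet_form \<nu> E F"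
    and "generator_of_form \<nu> E F D A"
    and "markovian_semigroup \<nu> T" and "infinitesimal_generator \<nu> T D A"
    and "hunt_process W P X" and "process_has_semigroup \<nu> P X T"
    and "\<And>\<delta>. \<delta> \<in> {0<..<1} \<Longrightarrow> stable_subordinator \<delta> (M \<delta>) (\<xi> \<delta>)"
    and "\<And>\<delta>. \<delta> \<in> {0<..<1} \<Longrightarrow> density_on_positive (M \<delta>) (\<xi> \<delta>) (\<eta> \<delta>)"
    and "\<And>\<delta>. \<delta> \<in> {0<..<1} \<Longrightarrow>
           process_has_semigroup \<nu> (subordinated_law P (M \<delta>)) (subordinated_process X (\<xi> \<delta>)) (T\<^sub>\<delta> \<delta>)"
    and "\<And>\<delta>. \<delta> \<in> {0<..<1} \<Longrightarrow> subordinated_semigroup \<nu> T (\<eta> \<delta>) (T\<^sub>\<delta> \<delta>)"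
  shows "F \<subseteq> (\<Inter>\<delta>\<in>{0<..<1}. semigroup_form_domain \<nu> (T\<^sub>\<delta> \<delta>)) \<and>
    (F = (\<Inter>\<delta>\<in>{0<..<1}. semigroup_form_domain \<nu> (T\<^sub>\<delta> \<delta>)) \<longleftrightarrow> l2_bounded_operator \<nu> D A)"
proof -
  let ?dom = "\<lambda>\<delta>. semigroup_form_domain \<nu> (T\<^sub>\<delta> \<delta>)"
  obtain B where B: "is_sqrt_of_minus \<nu> D A F B" "\<And>u v. u \<in> F \<Longrightarrow> v \<in> F \<Longrightarrow> E u v = l2_inner \<nu> (B u) (B v)"
    using assms(3) unfolding generator_of_form_def by blast
  have "l2_dense \<nu> D"
    using assms(3) unfolding generator_of_form_def l2_selfadjoint_def by blast
  moreover have "l2_symmetric_semigroup \<nu> T"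
    using assms(4) by (simp add: markovian_semigroup_def l2_symmetric_semigroup_def)
  ultimately interpret l2_generated_semigroup \<nu> T D A F B
    using assms(5) B(1) by (intro l2_generated_semigroup.intro l2_generated_semigroup_axioms.intro)
  have sub: "subordinated_generated_semigroup \<nu> T D A F B \<delta> (M \<delta>) (\<xi> \<delta>) (\<eta> \<delta>) (T\<^sub>\<delta> \<delta>)"
    if "\<delta> \<in> {0<..<1}" for \<delta>
  proof (intro subordinated_generated_semigroup.intro subordinated_l2_semigroup.intro
      subordinated_l2_semigroup_axioms.intro)
    show "l2_generated_semigroup \<nu> T D A F B" "l2_symmetric_semigroup \<nu> T" by unfold_locales
    show "0 < \<delta>" "\<delta> < 1" using that by auto
  qed (rule assms(8,9,11)[OF that])+
  have subset: "F \<subseteq> (\<Inter>\<delta>\<in>{0<..<1}. ?dom \<delta>)"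
    using subordinated_generated_semigroup.form_domain_subset[OF sub] by blast
  moreover have "l2_bounded_operator \<nu> D A" if eq: "F = (\<Inter>\<delta>\<in>{0<..<1}. ?dom \<delta>)"
  proof (rule ccontr)
    assume "\<not> l2_bounded_operator \<nu> D A"
    then have "\<exists>v\<in>D. C * (l2_norm \<nu> v)\<^sup>2 < (l2_norm \<nu> (B v))\<^sup>2" for C
      using bounded_generator_if_form_bounded[of C] by (meson not_le)
    \<comment> \<open>The hump is built from the base semigroup and its generator, so one u serves
      all indices at once.\<close>
    then obtain u S where "u \<in> L2 \<nu>" "u \<notin> F" "\<And>n. S n \<in> D"
      "(\<lambda>n. l2_norm \<nu> (\<lambda>x. u x - S n x)) \<longlonglongrightarrow> 0"
      "\<And>n. tame_increment n (\<lambda>x. S (Suc n) x - S n x)"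
      using gliding_hump by blast
    then have "u \<in> (\<Inter>\<delta>\<in>{0<..<1}. ?dom \<delta>)"
      using subordinated_generated_semigroup.limit_of_tame_increments_in_domain[OF sub] by blast
    then show False using \<open>u \<notin> F\<close> eq by blast
  qed
  moreover have "F = (\<Inter>\<delta>\<in>{0<..<1}. ?dom \<delta>)" if bounded: "l2_bounded_operator \<nu> D A"
  proof
    have "closed_form \<nu> E F"
      using assms(2) by (simp add: regular_dirichlet_form_def dirichlet_form_def)
    then have "F = L2 \<nu>"
      using B(2) bounded by (rule form_domain_eq_L2_if_bounded)
    \<comment> \<open>A single index suffices to confine the intersection to L2, which is F
      here.\<close>
    moreover have "(1 / 2 :: real) \<in> {0<..<1}" by simp
    ultimately show "(\<Inter>\<delta>\<in>{0<..<1}. ?dom \<delta>) \<subseteq> F"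
      unfolding semigroup_form_domain_def by blast
  qed (rule subset)
  ultimately show ?thesis by blast
qed

end
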